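(* Let $X$ be a compact metric space and $T:X\to X$ a surjective continuous map which is not one-to-one. Let $f\in C(X,\mathbb{R})$ and let $\mu$ be an ergodic $T$-invariant Borel probability measure with $h_{\mu}(T)>0$. Then for $\mu$-a.e. $x\in X$, $\lim_{\epsilon\to0}P_s(T,f,x,\epsilon)\geq P_{\mu}(T,f)$.
   Context: $W^s_{\epsilon}(x,T)=\{y\in X: d(T^nx,T^ny)\le\epsilon\ \forall n\ge0\}$. $f_n=\sum_{i=0}^{n-1}f\circ T^i$, $d_n(x,y)=\max_{0\le i<n}d(T^ix,T^iy)$, $P_n(T,f,\delta,K)=\sup\{\sum_{x\in E}\exp f_n(x): E\subseteq K,\ d_n(x,y)>\delta \text{ for distinct } x,y\in E\}$, and $P_s(T,f,x,\epsilon)=\lim_{\delta\to0}\limsup_{n\to\infty}\frac1n\log P_n(T,f,\delta,T^{-n}W^s_\epsilon(x,T))$, where $T^{-n}$ denotes the preimage. $P_\mu(T,f)=h_\mu(T)+\int f\,d\mu$. *)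

theory Defs
  imports "HOL-Probability.Probability"
begin

definition stable_set :: "('a::metric_space \<Rightarrow> 'a) \<Rightarrow> real \<Rightarrow> 'a \<Rightarrow> 'a set" where
  "stable_set T \<epsilon> x = {y. \<forall>n. dist ((T^^n) x) ((T^^n) y) \<le> \<epsilon>}"

definition birkhoff_sum :: "('a \<Rightarrow> 'a) \<Rightarrow> ('a \<Rightarrow> real) \<Rightarrow> nat \<Rightarrow> 'a \<Rightarrow> real" where
  "birkhoff_sum T f n x = (\<Sum>i<n. f ((T^^i) x))"

definition bowen_dist :: "('a::metric_space \<Rightarrow> 'a) \<Rightarrow> nat \<Rightarrow> 'a \<Rightarrow> 'a \<Rightarrow> real" where
  "bowen_dist T n x y = (MAX i\<in>{..<n}. dist ((T^^i) x) ((T^^i) y))"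

definition Pn :: "('a::metric_space \<Rightarrow> 'a) \<Rightarrow> ('a \<Rightarrow> real) \<Rightarrow> nat \<Rightarrow> real \<Rightarrow> 'a set \<Rightarrow> ereal" where
  "Pn T f n \<delta> K = Sup {ereal (\<Sum>x\<in>E. exp (birkhoff_sum T f n x)) | E.
       finite E \<and> E \<subseteq> K \<and> (\<forall>x\<in>E. \<forall>y\<in>E. x \<noteq> y \<longrightarrow> bowen_dist T n x y > \<delta>)}"

definition eln :: "ereal \<Rightarrow> ereal" where
  "eln a = (if a = \<infinity> then \<infinity> else if a > 0 then ereal (ln (real_of_ereal a)) else - \<infinity>)"

definition Ps :: "('a::metric_space \<Rightarrow> 'a) \<Rightarrow> ('a \<Rightarrow> real) \<Rightarrow> 'a \<Rightarrow> real \<Rightarrow> ereal" where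
  "Ps T f x \<epsilon> = Lim (at_right 0) (\<lambda>\<delta>.
      limsup (\<lambda>n. ereal (1 / real n) * eln (Pn T f n \<delta> ((T^^n) -` stable_set T \<epsilon> x))))"

definition invariant_measure :: "'a measure \<Rightarrow> ('a \<Rightarrow> 'a) \<Rightarrow> bool" where
  "invariant_measure M T \<longleftrightarrow> T \<in> measurable M M \<and>
     (\<forall>A\<in>sets M. measure M (T -` A \<inter> space M) = measure M A)"

definition ergodic_measure :: "'a measure \<Rightarrow> ('a \<Rightarrow> 'a) \<Rightarrow> bool" where
  "ergodic_measure M T \<longleftrightarrow> invariant_measure M T \<and>
     (\<forall>A\<in>sets M. T -` A \<inter> space M = A \<longrightarrow> measure M A = 0 \<or> measure M A = 1)"

definition meas_partition :: "'a measure \<Rightarrow> 'a set set \<Rightarrow> bool" where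
  "meas_partition M P \<longleftrightarrow> finite P \<and> P \<subseteq> sets M \<and> disjoint P \<and> \<Union>P = space M"

definition join_partition :: "'a measure \<Rightarrow> ('a \<Rightarrow> 'a) \<Rightarrow> 'a set set \<Rightarrow> nat \<Rightarrow> 'a set set" where
  "join_partition M T P n =
     {C. C \<noteq> {} \<and> (\<exists>a. (\<forall>i<n. a i \<in> P) \<and> C = space M \<inter> (\<Inter>i<n. (T^^i) -` a i))}"

definition partition_entropy :: "'a measure \<Rightarrow> 'a set set \<Rightarrow> real" where
  "partition_entropy M P = - (\<Sum>A\<in>P. measure M A * ln (measure M A))"

definition entropy_partition_T :: "'a measure \<Rightarrow> ('a \<Rightarrow> 'a) \<Rightarrow> 'a set set \<Rightarrow> real" where
  "entropy_partition_T M T P = lim (\<lambda>n. partition_entropy M (join_partition M T P n) / real n)"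

definition ks_entropy :: "'a measure \<Rightarrow> ('a \<Rightarrow> 'a) \<Rightarrow> ereal" where
  "ks_entropy M T = (SUP P\<in>{P. meas_partition M P}. ereal (entropy_partition_T M T P))"

definition measure_pressure :: "'a measure \<Rightarrow> ('a \<Rightarrow> 'a) \<Rightarrow> ('a \<Rightarrow> real) \<Rightarrow> ereal" where
  "measure_pressure M T f = ks_entropy M T + ereal (integral\<^sup>L M f)"

end

theory Submission
  imports Defs
begin

text \<open>
  Refine a partition of almost maximal entropy by sets of diameter at most \<open>\<epsilon>\<close>, and code points
  by their itineraries. A point \<open>z\<close> such that \<open>T\<^sup>n z\<close> has the same \<open>N\<close>-word as \<open>x\<close> lies, up to
  the horizon \<open>N\<close>, in \<open>T\<^sup>-\<^sup>n W\<^sup>s\<^sub>\<epsilon>(x,T)\<close>; by compactness, separated sets of such points survive the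
  limit \<open>N \<rightarrow> \<infinity>\<close> for fixed \<open>n\<close>. It therefore suffices to find many of them, uniformly in \<open>N\<close>.

  Given the last \<open>N\<close> letters of an \<open>(n + N)\<close>-word, its first \<open>n\<close> letters carry an information of
  mean at least \<open>n h\<close>. Comparison with the backward Markov chain of a fixed order \<open>k\<close> bounds
  this information from above, up to a function of positive part at most 1 in the mean, by a
  Birkhoff sum whose mean is close to \<open>n h\<close>. The ergodic theorem for that sum forces the information
  to be at least \<open>n (h - r)\<close> with high probability, so most fibres \<open>T\<^sup>-\<^sup>n(N-cylinder)\<close> contain
  about \<open>exp (n h)\<close> different \<open>n\<close>-words with typical Birkhoff sums of \<open>f\<close>. Points with these words
  become separated after discarding a factor \<open>exp (n r)\<close>: outside a set of small measure the
  partition elements are at a positive distance, and a Hamming ball of small radius contains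
  few words.
\<close>

section \<open>The ergodic theorem in probability\<close>

text \<open>The space is fixed to be the whole type, so preimages of events are events without
  intersecting with \<open>space M\<close>.\<close>

locale mps = prob_space M for M :: "'a measure" +
  fixes T :: "'a \<Rightarrow> 'a"
  assumes space_UNIV: "space M = UNIV"
    and T_measurable [measurable]: "T \<in> measurable M M"
    and T_inv: "A \<in> sets M \<Longrightarrow> measure M (T -` A) = measure M A"
begin

lemma Compl_sets [measurable]: "A \<in> sets M \<Longrightarrow> - A \<in> sets M"
  using sets.compl_sets[of A M] by (simp add: space_UNIV Compl_eq_Diff_UNIV)

lemma prob_Compl: "A \<in> sets M \<Longrightarrow> prob (- A) = 1 - prob A"
  using prob_compl[of A] by (simp add: space_UNIV Compl_eq_Diff_UNIV)

lemma distr_T: "distr M M T = M"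
proof (rule measure_eqI)
  fix A assume "A \<in> sets (distr M M T)"
  then have "A \<in> sets M" by simp
  then show "emeasure (distr M M T) A = emeasure M A"
    using T_inv by (simp add: emeasure_distr space_UNIV emeasure_eq_measure)
qed simp

lemma integral_comp_T:
  fixes g :: "'a \<Rightarrow> real"
  assumes [measurable]: "g \<in> borel_measurable M"
  shows "(\<integral>x. g (T x) \<partial>M) = (\<integral>x. g x \<partial>M)"
  using integral_distr[OF T_measurable assms] by (simp add: distr_T)

lemma iterate_measurable [measurable]: "T ^^ n \<in> measurable M M"
  by (induction n) (simp_all add: id_def comp_def)

lemma integral_comp_iterate:
  fixes g :: "'a \<Rightarrow> real"
  assumes [measurable]: "g \<in> borel_measurable M"
  shows "(\<integral>x. g ((T ^^ n) x) \<partial>M) = (\<integral>x. g x \<partial>M)"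
proof (induction n)
  case (Suc n)
  have "(\<integral>x. g ((T ^^ Suc n) x) \<partial>M) = (\<integral>x. g ((T ^^ n) (T x)) \<partial>M)"
    by (simp add: funpow_swap1)
  also have "\<dots> = (\<integral>x. g ((T ^^ n) x) \<partial>M)"
    by (rule integral_comp_T) simp
  finally show ?case using Suc by simp
qed simp

lemma prob_vimage_iterate:
  assumes "A \<in> sets M"
  shows "prob ((T ^^ n) -` A) = prob A"
proof (induction n)
  case (Suc n)
  have "(T ^^ n) -` A \<in> sets M"
    using measurable_sets[OF iterate_measurable assms] by (simp add: space_UNIV)
  moreover have "(T ^^ Suc n) -` A = T -` ((T ^^ n) -` A)"
    by (auto simp: funpow_swap1)
  ultimately show ?case using Suc T_inv by (metis (no_types))
qed simp

lemma birkhoff_sum_measurable [measurable]: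
  assumes [measurable]: "g \<in> borel_measurable M"
  shows "birkhoff_sum T g n \<in> borel_measurable M"
  unfolding birkhoff_sum_def by measurable

lemma integral_birkhoff_sum:
  fixes B :: real
  assumes [measurable]: "g \<in> borel_measurable M" and "\<And>x. \<bar>g x\<bar> \<le> B"
  shows "(\<integral>x. birkhoff_sum T g n x \<partial>M) = real n * (\<integral>x. g x \<partial>M)"
proof -
  have "integrable M (\<lambda>x. g ((T ^^ i) x))" for i
    by (rule integrable_const_bound[of _ B]) (auto simp: assms(2))
  then show ?thesis
    by (simp add: birkhoff_sum_def Bochner_Integration.integral_sum integral_comp_iterate)
qed

end

section \<open>Running maxima of Birkhoff sums and the maximal ergodic theorem\<close>

lemma birkhoff_sum_0 [simp]: "birkhoff_sum T g 0 x = 0"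
  by (simp add: birkhoff_sum_def)

lemma birkhoff_sum_Suc: "birkhoff_sum T g (Suc n) x = g x + birkhoff_sum T g n (T x)"
  unfolding birkhoff_sum_def by (simp only: sum.lessThan_Suc_shift funpow_Suc_right) simp

lemma abs_birkhoff_sum_le:
  assumes "\<And>x. \<bar>g x\<bar> \<le> B"
  shows "\<bar>birkhoff_sum T g n x\<bar> \<le> real n * B"
proof -
  have "\<bar>birkhoff_sum T g n x\<bar> \<le> (\<Sum>i<n. \<bar>g ((T ^^ i) x)\<bar>)"
    unfolding birkhoff_sum_def by (rule sum_abs)
  also have "\<dots> \<le> (\<Sum>i<n. B)" by (intro sum_mono assms)
  finally show ?thesis by simp
qed

text \<open>The maximum of the Birkhoff sums of lengths \<open>0, \<dots>, n\<close>.\<close>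
primrec max_birkhoff :: "('a \<Rightarrow> 'a) \<Rightarrow> ('a \<Rightarrow> real) \<Rightarrow> nat \<Rightarrow> 'a \<Rightarrow> real" where
  "max_birkhoff T g 0 = (\<lambda>x. 0)"
| "max_birkhoff T g (Suc n) = (\<lambda>x. max 0 (g x + max_birkhoff T g n (T x)))"

lemma max_birkhoff_nonneg: "0 \<le> max_birkhoff T g n x"
  by (cases n) simp_all

lemma max_birkhoff_le_Suc: "max_birkhoff T g n x \<le> max_birkhoff T g (Suc n) x"
proof (induction n arbitrary: x)
  case (Suc n)
  have "max_birkhoff T g n (T x) \<le> max_birkhoff T g (Suc n) (T x)" by (rule Suc)
  then show ?case
    unfolding max_birkhoff.simps(2)[of T g n] max_birkhoff.simps(2)[of T g "Suc n"]
    by linarith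
qed simp

lemma max_birkhoff_mono: "m \<le> n \<Longrightarrow> max_birkhoff T g m x \<le> max_birkhoff T g n x"
  by (rule lift_Suc_mono_le[of "\<lambda>n. max_birkhoff T g n x"]) (rule max_birkhoff_le_Suc)

lemma birkhoff_sum_le_max: "birkhoff_sum T g n x \<le> max_birkhoff T g n x"
proof (induction n arbitrary: x)
  case (Suc n)
  from Suc[of "T x"] show ?case by (simp add: birkhoff_sum_Suc)
qed simp

lemma max_birkhoff_le:
  assumes "\<And>x. \<bar>g x\<bar> \<le> B"
  shows "max_birkhoff T g n x \<le> real n * B"
proof (induction n arbitrary: x)
  case (Suc n)
  have "0 \<le> B" using assms[of x] by linarith
  with Suc[of "T x"] assms[of x] show ?case by (auto simp: algebra_simps)
qed simp

context mps
begin

lemma max_birkhoff_measurable [measurable]: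
  assumes [measurable]: "g \<in> borel_measurable M"
  shows "max_birkhoff T g n \<in> borel_measurable M"
  by (induction n) simp_all

text \<open>Maximal ergodic theorem by Garsia's argument. Where the maximum \<open>?m\<close> is
  positive, the recursion and monotonicity in \<open>n\<close> give
  \<open>?m x \<le> g x + ?m (T x)\<close>; elsewhere \<open>?m x = 0 \<le> ?m (T x)\<close>.
  Integrating, the two copies of \<open>?m\<close> cancel by invariance.\<close>

lemma max_birkhoff_integral_nonneg:
  assumes [measurable]: "g \<in> borel_measurable M" and B: "\<And>x. \<bar>g x\<bar> \<le> B"
  shows "0 \<le> (\<integral>x. indicator {x. 0 < max_birkhoff T g n x} x * g x \<partial>M)"
proof -
  let ?m = "max_birkhoff T g n"
  have m_abs: "\<bar>?m x\<bar> \<le> real n * B" for x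
    using max_birkhoff_nonneg[of T g n x] max_birkhoff_le[of g B T n x] B by simp
  have S [measurable]: "{x. 0 < ?m x} \<in> sets M"
    using borel_measurable_less[of "\<lambda>_. 0" M ?m] by (simp add: space_UNIV)
  have i1: "integrable M ?m" by (rule integrable_const_bound[of _ "real n * B"]) (auto simp: m_abs)
  have i2: "integrable M (\<lambda>x. ?m (T x))"
    by (rule integrable_const_bound[of _ "real n * B"]) (auto simp: m_abs)
  have i3: "integrable M (\<lambda>x. indicator {x. 0 < ?m x} x * g x)"
  proof (rule integrable_const_bound[of _ B])
    show "AE x in M. norm (indicator {x. 0 < ?m x} x * g x) \<le> B"
      using B by (auto split: split_indicator intro: order_trans[OF abs_ge_zero])
  qed measurable
  have pw: "?m x - ?m (T x) \<le> indicator {x. 0 < ?m x} x * g x" for x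
  proof (cases "0 < ?m x")
    case True
    then obtain k where n: "n = Suc k" by (cases n) auto
    have "?m x = g x + max_birkhoff T g k (T x)" using True by (simp add: n max_def split: if_splits)
    also have "max_birkhoff T g k (T x) \<le> ?m (T x)" unfolding n by (rule max_birkhoff_le_Suc)
    finally show ?thesis using True by simp
  next
    case False
    then show ?thesis using max_birkhoff_nonneg[of T g n "T x"] by simp
  qed
  have "(\<integral>x. ?m x - ?m (T x) \<partial>M) = 0"
    using i1 i2 by (simp add: integral_comp_T)
  moreover have "(\<integral>x. ?m x - ?m (T x) \<partial>M) \<le> (\<integral>x. indicator {x. 0 < ?m x} x * g x \<partial>M)"
    using i1 i2 i3 pw by (intro integral_mono) auto
  ultimately show ?thesis by simp
qed

text \<open>The sets where the running maximum is positive increase to a set of full measure.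
  Replacing the integral over such a set by the full integral costs at most \<open>B\<close> times
  the measure of its complement, which tends to 0.\<close>

lemma integral_nonneg_if_birkhoff_sum_pos:
  assumes [measurable]: "g \<in> borel_measurable M" and B: "\<And>x. \<bar>g x\<bar> \<le> B"
    and pos: "AE x in M. \<exists>n. 0 < birkhoff_sum T g n x"
  shows "0 \<le> (\<integral>x. g x \<partial>M)"
proof -
  let ?A = "\<lambda>n. {x. 0 < max_birkhoff T g n x}"
  have A [measurable]: "?A n \<in> sets M" for n
    using borel_measurable_less[of "\<lambda>_. 0" M "max_birkhoff T g n"] by (simp add: space_UNIV)
  have inc: "incseq ?A"
    by (auto simp: incseq_def intro: less_le_trans[OF _ max_birkhoff_mono])
  have "AE x in M. x \<in> (\<Union>n. ?A n)"
    using pos by eventually_elim (auto intro: less_le_trans[OF _ birkhoff_sum_le_max])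
  then have "prob (\<Union>n. ?A n) = 1"
    by (subst prob_eq_1) auto
  moreover have "range ?A \<subseteq> events" using A by blast
  ultimately have lim: "(\<lambda>n. prob (?A n)) \<longlonglongrightarrow> 1"
    using finite_Lim_measure_incseq[OF _ inc] by metis
  have ig: "integrable M g" by (rule integrable_const_bound[of _ B]) (auto simp: B)
  have lower: "- B * (1 - prob (?A n)) \<le> (\<integral>x. g x \<partial>M)" for n
  proof -
    have iB: "integrable M (\<lambda>x. B * indicator (- ?A n) x)"
      by (intro integrable_mult_right integrable_real_indicator Compl_sets A)
        (simp add: emeasure_eq_measure)
    have "0 \<le> (\<integral>x. indicator (?A n) x * g x \<partial>M)"
      using B by (intro max_birkhoff_integral_nonneg) auto
    also have "\<dots> \<le> (\<integral>x. g x + B * indicator (- ?A n) x \<partial>M)"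
    proof (rule integral_mono)
      show "integrable M (\<lambda>x. indicator (?A n) x * g x)"
        using integrable_real_mult_indicator[OF A ig] by (simp add: mult.commute)
      show "integrable M (\<lambda>x. g x + B * indicator (- ?A n) x)"
        by (intro Bochner_Integration.integrable_add ig iB)
      show "indicator (?A n) x * g x \<le> g x + B * indicator (- ?A n) x" for x
        using B[of x] by (auto split: split_indicator)
    qed
    also have "\<dots> = (\<integral>x. g x \<partial>M) + B * prob (- ?A n)"
      by (subst Bochner_Integration.integral_add[OF ig iB]) simp
    also have "prob (- ?A n) = 1 - prob (?A n)"
      by (rule prob_Compl[OF A])
    finally show ?thesis by simp
  qed
  have "(\<lambda>n. - B * (1 - prob (?A n))) \<longlonglongrightarrow> - B * (1 - 1)"
    by (intro tendsto_intros lim)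
  then show ?thesis
    using lower by (intro LIMSEQ_le_const2[of _ 0]) auto
qed

end

section \<open>Concentration of Birkhoff sums under ergodicity\<close>

locale ergodic_mps = mps +
  assumes ergodic: "A \<in> sets M \<Longrightarrow> T -` A = A \<Longrightarrow> measure M A = 0 \<or> measure M A = 1"
begin

text \<open>The set where the sums are unbounded above is exactly invariant, because passing from
  \<open>x\<close> to \<open>T x\<close> changes them by a bounded amount. By ergodicity its measure
  is 0 or 1, and measure 1 would force a nonnegative mean.\<close>

lemma AE_birkhoff_sum_bounded_above:
  assumes [measurable]: "g \<in> borel_measurable M" and B: "\<And>x. \<bar>g x\<bar> \<le> B"
    and neg: "(\<integral>x. g x \<partial>M) < 0"
  shows "AE x in M. \<exists>K::nat. \<forall>n. birkhoff_sum T g n x \<le> real K"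
proof -
  let ?C = "{x. \<forall>K::nat. \<exists>n. real K < birkhoff_sum T g n x}"
  have C: "?C \<in> sets M"
  proof -
    have "{x \<in> space M. \<forall>K::nat. \<exists>n. real K < birkhoff_sum T g n x} \<in> sets M" by measurable
    then show ?thesis by (simp add: space_UNIV)
  qed
  have "T -` ?C = ?C"
  proof (intro set_eqI iffI)
    fix x assume x: "x \<in> T -` ?C"
    show "x \<in> ?C"
    proof (intro CollectI allI)
      fix K :: nat
      \<comment> \<open>The surplus \<open>nat \<lceil>B\<rceil>\<close> absorbs the single term
        \<open>g x\<close> by which the sums at \<open>x\<close> and at \<open>T x\<close>
        differ.\<close>
      obtain n where "real (K + nat \<lceil>B\<rceil>) < birkhoff_sum T g n (T x)" using x by blast
      then have "real K < birkhoff_sum T g (Suc n) x"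
        using B[of x] by (simp add: birkhoff_sum_Suc) linarith
      then show "\<exists>n. real K < birkhoff_sum T g n x" ..
    qed
  next
    fix x assume x: "x \<in> ?C"
    have "\<exists>n. real K < birkhoff_sum T g n (T x)" for K :: nat
    proof -
      obtain n where n: "real (K + nat \<lceil>B\<rceil>) < birkhoff_sum T g n x" using x by blast
      then obtain k where "n = Suc k" by (cases n) auto
      then have "real K < birkhoff_sum T g k (T x)"
        using n B[of x] by (simp add: birkhoff_sum_Suc) linarith
      then show ?thesis ..
    qed
    then show "x \<in> T -` ?C" by auto
  qed
  moreover have "prob ?C \<noteq> 1"
  proof
    assume "prob ?C = 1"
    then have "AE x in M. x \<in> ?C" using prob_eq_1[OF C] by simp
    then have "AE x in M. \<exists>n. 0 < birkhoff_sum T g n x"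
    proof eventually_elim
      case (elim x)
      then have "\<exists>n. real 0 < birkhoff_sum T g n x" by blast
      then show ?case by simp
    qed
    then have "0 \<le> (\<integral>x. g x \<partial>M)" by (intro integral_nonneg_if_birkhoff_sum_pos[of g B]) (auto simp: B)
    with neg show False by simp
  qed
  ultimately have "prob ?C = 0" using ergodic[OF C] by auto
  then have "AE x in M. x \<notin> ?C" using prob_eq_0[OF C] by simp
  then show ?thesis by eventually_elim (auto simp: not_less)
qed

text \<open>After centring, the sums are almost everywhere bounded above, so one bound
  \<open>K\<close> works for all \<open>n\<close> at once outside a set of measure less than
  \<open>z\<close>. For \<open>n\<close> large compared with \<open>K\<close> the tail event lies in
  that exceptional set.\<close>

theorem birkhoff_lower_tail:
  assumes [measurable]: "g \<in> borel_measurable M" and B: "\<And>x. \<bar>g x\<bar> \<le> B"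
    and r: "0 < r" and z: "0 < z"
  shows "\<exists>n0. \<forall>n\<ge>n0. prob {x. birkhoff_sum T g n x < real n * ((\<integral>x. g x \<partial>M) - r)} \<le> z"
proof -
  \<comment> \<open>Half of \<open>r\<close> makes the mean of \<open>?g\<close> negative; the other
    half makes the sum of \<open>?g\<close> exceed \<open>n * r / 2\<close> on the tail
    event.\<close>
  let ?c = "(\<integral>x. g x \<partial>M) - r / 2"
  let ?g = "\<lambda>x. ?c - g x"
  have ig: "integrable M g" by (rule integrable_const_bound[of _ B]) (auto simp: B)
  have int: "(\<integral>x. ?g x \<partial>M) = - r / 2" using ig by (simp add: prob_space)
  have bd: "\<bar>?g x\<bar> \<le> \<bar>?c\<bar> + B" for x using B[of x] by linarith
  have AE: "AE x in M. \<exists>K::nat. \<forall>n. birkhoff_sum T ?g n x \<le> real K"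
    by (rule AE_birkhoff_sum_bounded_above[of ?g "\<bar>?c\<bar> + B"]) (use bd int r in auto)
  let ?D = "\<lambda>K::nat. {x. \<forall>n. birkhoff_sum T ?g n x \<le> real K}"
  have D: "?D K \<in> sets M" for K
  proof -
    have "{x \<in> space M. \<forall>n. birkhoff_sum T ?g n x \<le> real K} \<in> sets M" by measurable
    then show ?thesis by (simp add: space_UNIV)
  qed
  have inc: "incseq ?D" by (auto simp: incseq_def intro: order_trans)
  have "prob (\<Union>K. ?D K) = 1"
    using AE D by (subst prob_eq_1) auto
  moreover have "range ?D \<subseteq> events" using D by blast
  ultimately have lim: "(\<lambda>n. prob (?D n)) \<longlonglongrightarrow> 1"
    using finite_Lim_measure_incseq[OF _ inc] by metis
  then have "eventually (\<lambda>K. 1 - z < prob (?D K)) sequentially"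
    using z by (intro order_tendstoD) auto
  then obtain K where K: "1 - z < prob (?D K)" by (auto simp: eventually_sequentially)
  obtain n0 :: nat where n0: "real K * 2 / r < real n0" using reals_Archimedean2 by blast
  show ?thesis
  proof (intro exI[of _ n0] allI impI)
    fix n assume n: "n0 \<le> n"
    let ?E = "{x. birkhoff_sum T g n x < real n * ((\<integral>x. g x \<partial>M) - r)}"
    have Kn: "real K < real n * r / 2"
    proof -
      have "real K * 2 / r < real n" using n0 n by linarith
      then show ?thesis using r by (simp add: field_simps)
    qed
    have "?E \<subseteq> - ?D K"
    proof
      fix x assume x: "x \<in> ?E"
      have "birkhoff_sum T ?g n x = real n * ?c - birkhoff_sum T g n x"
        by (simp add: birkhoff_sum_def sum_subtractf)
      also have "\<dots> > real n * r / 2" using x by (simp add: algebra_simps)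
      finally have "real K < birkhoff_sum T ?g n x" using Kn by linarith
      then show "x \<in> - ?D K" by (auto simp: not_le)
    qed
    then have "prob ?E \<le> prob (- ?D K)"
      using D[of K] by (intro finite_measure_mono Compl_sets)
    also have "\<dots> = 1 - prob (?D K)"
      by (rule prob_Compl[OF D])
    finally show "prob ?E \<le> z" using K by simp
  qed
qed

end

section \<open>Entropy of finitely labelled processes\<close>

definition word :: "('a \<Rightarrow> 'a) \<Rightarrow> ('a \<Rightarrow> 'b) \<Rightarrow> nat \<Rightarrow> 'a \<Rightarrow> 'b list" where
  "word T l n x = map (\<lambda>i. l ((T ^^ i) x)) [0..<n]"

lemma length_word [simp]: "length (word T l n x) = n"
  by (simp add: word_def)

lemma word_0 [simp]: "word T l 0 x = []"
  by (simp add: word_def)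

lemma word_Suc: "word T l (Suc n) x = l x # word T l n (T x)"
  unfolding word_def by (simp add: upt_conv_Cons map_Suc_upt[symmetric] funpow_swap1 del: upt_Suc map_Suc_upt)

lemma word_add: "word T l (m + n) x = word T l m x @ word T l n ((T ^^ m) x)"
  by (induction m arbitrary: x) (simp_all add: word_Suc funpow_swap1)

lemma take_word: "m \<le> n \<Longrightarrow> take m (word T l n x) = word T l m x"
  using word_add[of T l m "n - m" x] by simp

lemma nth_word: "i < n \<Longrightarrow> word T l n x ! i = l ((T ^^ i) x)"
  by (simp add: word_def)

lemma sum_lists_Suc:
  fixes G :: "'b list \<Rightarrow> real"
  shows "(\<Sum>w | set w \<subseteq> L \<and> length w = Suc n. G w) =
    (\<Sum>v | set v \<subseteq> L \<and> length v = n. \<Sum>a\<in>L. G (a # v))"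
proof -
  let ?W = "{v. set v \<subseteq> L \<and> length v = n}"
  have "(\<Sum>w | set w \<subseteq> L \<and> length w = Suc n. G w) = (\<Sum>(a, v)\<in>L \<times> ?W. G (a # v))"
    by (rule sum.reindex_bij_witness[of _ "\<lambda>(a, v). a # v" "\<lambda>w. (hd w, tl w)"])
      (auto simp: length_Suc_conv)
  also have "\<dots> = (\<Sum>a\<in>L. \<Sum>v\<in>?W. G (a # v))"
    by (rule sum.cartesian_product[symmetric])
  also have "\<dots> = (\<Sum>v\<in>?W. \<Sum>a\<in>L. G (a # v))" by (rule sum.swap)
  finally show ?thesis .
qed

section \<open>Cylinder sets of a finitely labelled process\<close>

locale labelled_mps = mps +
  fixes l :: "'a \<Rightarrow> 'b" and L :: "'b set"
  assumes finite_L: "finite L"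
    and l_measurable: "l \<in> measurable M (count_space L)"
begin

abbreviation "wd \<equiv> word T l"
abbreviation "W n \<equiv> {w. set w \<subseteq> L \<and> length w = n}"

definition cyl :: "'b list \<Rightarrow> 'a set" where
  "cyl w = {x. wd (length w) x = w}"

definition p :: "'b list \<Rightarrow> real" where
  "p w = prob (cyl w)"

lemma l_in: "l x \<in> L"
  using measurable_space[OF l_measurable, of x] by (simp add: space_UNIV)

lemma word_in: "wd n x \<in> W n"
  using l_in by (auto simp: word_def)

lemma finite_W: "finite (W n)"
  by (rule finite_lists_length_eq[OF finite_L])

lemma cyl_Nil: "cyl [] = UNIV"
  by (simp add: cyl_def)

lemma cyl_Cons: "cyl (a # w) = l -` {a} \<inter> T -` cyl w"
  by (auto simp: cyl_def word_Suc)

lemma cyl_sets [measurable]: "cyl w \<in> sets M"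
proof (induction w)
  case Nil
  then show ?case using sets.top[of M] by (simp add: cyl_Nil space_UNIV)
next
  case (Cons a w)
  have "l -` {a} \<in> sets M"
  proof (cases "a \<in> L")
    case True
    then show ?thesis using measurable_sets[OF l_measurable, of "{a}"] by (simp add: space_UNIV)
  next
    case False
    then have "l -` {a} = {}" using l_in by auto
    then show ?thesis by simp
  qed
  moreover have "T -` cyl w \<in> sets M"
    using measurable_sets[OF T_measurable Cons] by (simp add: space_UNIV)
  ultimately show ?case unfolding cyl_Cons by (rule sets.Int)
qed

lemma p_nonneg: "0 \<le> p w"
  by (simp add: p_def)

lemma p_Nil: "p [] = 1"
  using prob_space by (simp add: p_def cyl_Nil space_UNIV)

lemma p_append_le_left: "p (u @ v) \<le> p u"
  unfolding p_def by (intro finite_measure_mono cyl_sets) (auto simp: cyl_def word_add)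

lemma p_append_le_right: "p (u @ v) \<le> p v"
proof -
  have "p (u @ v) \<le> prob ((T ^^ length u) -` cyl v)"
    unfolding p_def
    using measurable_sets[OF iterate_measurable cyl_sets, of "length u" v]
    by (intro finite_measure_mono) (auto simp: cyl_def word_add space_UNIV)
  then show ?thesis by (simp add: p_def prob_vimage_iterate)
qed

lemma sum_p_Cons: "(\<Sum>a\<in>L. p (a # w)) = p w"
proof -
  have "(\<Sum>a\<in>L. p (a # w)) = prob (\<Union>a\<in>L. cyl (a # w))"
    unfolding p_def
  proof (rule finite_measure_finite_Union[symmetric])
    show "(\<lambda>a. cyl (a # w)) ` L \<subseteq> events" using cyl_sets by blast
  qed (auto simp: finite_L disjoint_family_on_def cyl_Cons)
  also have "(\<Union>a\<in>L. cyl (a # w)) = T -` cyl w"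
    using l_in by (auto simp: cyl_Cons)
  also have "prob \<dots> = p w" by (simp add: p_def T_inv)
  finally show ?thesis .
qed

text \<open>Any function of the \<open>n\<close>-word is a finite combination of cylinder
  indicators; its measurability, integrability and integral are read off from this form.\<close>

lemma function_of_word_sum:
  fixes F :: "'b list \<Rightarrow> real"
  shows "F (wd n x) = (\<Sum>w\<in>W n. F w * indicator (cyl w) x)"
proof -
  have "(\<Sum>w\<in>W n. F w * indicator (cyl w) x) = (\<Sum>w\<in>W n. if w = wd n x then F w else 0)"
    by (intro sum.cong) (auto simp: cyl_def split: split_indicator)
  also have "\<dots> = F (wd n x)" using word_in[of n x] finite_W by (simp add: sum.delta)
  finally show ?thesis by simp
qed

lemma function_of_word_measurable [measurable]:
  "(\<lambda>x. F (wd n x) :: real) \<in> borel_measurable M"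
  unfolding function_of_word_sum[of F n] by measurable

lemma integrable_cyl: "integrable M (indicator (cyl w) :: 'a \<Rightarrow> real)"
  by (rule integrable_real_indicator) (simp_all add: emeasure_eq_measure)

lemma function_of_word_integrable:
  "integrable M (\<lambda>x. F (wd n x) :: real)"
  unfolding function_of_word_sum[of F n]
  by (intro Bochner_Integration.integrable_sum integrable_mult_right integrable_cyl)

lemma integral_function_of_word:
  "(\<integral>x. F (wd n x) \<partial>M) = (\<Sum>w\<in>W n. p w * F w)"
proof -
  have "(\<integral>x. F (wd n x) \<partial>M) = (\<Sum>w\<in>W n. \<integral>x. F w * indicator (cyl w) x \<partial>M)"
    unfolding function_of_word_sum[of F n]
    by (intro Bochner_Integration.integral_sum integrable_mult_right integrable_cyl)
  also have "\<dots> = (\<Sum>w\<in>W n. p w * F w)"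
    by (intro sum.cong) (simp_all add: p_def mult.commute)
  finally show ?thesis .
qed

text \<open>There are finitely many words of length \<open>n\<close>, so the null cylinders together
  form a null set. Outside it the logarithms of cylinder measures used below have positive
  arguments.\<close>

lemma AE_p_word_pos: "AE x in M. 0 < p (wd n x)"
proof -
  have "AE x in M. \<forall>w\<in>W n. p w = 0 \<longrightarrow> x \<notin> cyl w"
  proof (rule AE_finite_allI[OF finite_W])
    fix w
    show "AE x in M. p w = 0 \<longrightarrow> x \<notin> cyl w"
      using prob_eq_0[OF cyl_sets, of w] by (cases "p w = 0") (simp_all add: p_def)
  qed
  then show ?thesis
  proof eventually_elim
    case (elim x)
    have "x \<in> cyl (wd n x)" by (simp add: cyl_def)
    then show ?case using elim word_in[of n x] p_nonneg[of "wd n x"] by (auto simp: less_le)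
  qed
qed

text \<open>The probability of the first \<open>n\<close> letters given the remaining ones, in the approximation
  of the process by a Markov chain of order \<open>k\<close> running backwards.\<close>
primrec markov :: "nat \<Rightarrow> nat \<Rightarrow> 'b list \<Rightarrow> real" where
  "markov k 0 w = 1"
| "markov k (Suc n) w = p (take (Suc k) w) / p (take k (tl w)) * markov k n (tl w)"

lemma markov_nonneg: "0 \<le> markov k n w"
  by (induction n arbitrary: w) (simp_all add: p_nonneg)

text \<open>The summand is the law of a word whose last \<open>N\<close> letters have their true
  distribution and whose first \<open>n\<close> letters are prepended by the Markov transitions.
  Only an inequality is claimed because the transitions out of a null word are 0 by the convention
  for division by zero.\<close>

lemma sum_markov_le:
  assumes "k \<le> N"
  shows "(\<Sum>w\<in>W (n + N). p (drop n w) * markov k n w) \<le> 1"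
proof (induction n)
  case 0
  show ?case using integral_function_of_word[of "\<lambda>_. 1" N] by (simp add: prob_space)
next
  case (Suc n)
  have "(\<Sum>w\<in>W (Suc n + N). p (drop (Suc n) w) * markov k (Suc n) w) =
      (\<Sum>v\<in>W (n + N). \<Sum>a\<in>L. p (drop n v) * markov k n v * (p (a # take k v) / p (take k v)))"
    unfolding add_Suc sum_lists_Suc by (simp add: mult_ac)
  also have "\<dots> = (\<Sum>v\<in>W (n + N). p (drop n v) * markov k n v * (p (take k v) / p (take k v)))"
    by (simp only: sum_distrib_left[symmetric] sum_divide_distrib[symmetric] sum_p_Cons)
  also have "\<dots> \<le> (\<Sum>v\<in>W (n + N). p (drop n v) * markov k n v * 1)"
    by (intro sum_mono mult_left_mono) (auto simp: p_nonneg markov_nonneg)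
  also have "\<dots> \<le> 1" using Suc by simp
  finally show ?case .
qed

section \<open>Conditional information compared with the Markov approximation\<close>

text \<open>The conditional information of the first letter given the next \<open>k\<close> letters,
  that is, minus the logarithm of a Markov transition probability. \<open>block_info\<close> is the
  analogue for the first \<open>n\<close> letters given the next \<open>N\<close>, and
  \<open>word_entropy\<close> is the Shannon entropy of the \<open>n\<close>-words.\<close>

definition info :: "nat \<Rightarrow> 'a \<Rightarrow> real" where
  "info k x = ln (p (wd k (T x))) - ln (p (wd (Suc k) x))"

definition block_info :: "nat \<Rightarrow> nat \<Rightarrow> 'a \<Rightarrow> real" where
  "block_info n N x = ln (p (wd N ((T ^^ n) x))) - ln (p (wd (n + N) x))"

definition word_entropy :: "nat \<Rightarrow> real" where
  "word_entropy n = (\<integral>x. - ln (p (wd n x)) \<partial>M)"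

lemma block_info_eq:
  "block_info n N x = (\<lambda>w. ln (p (drop n w)) - ln (p w)) (wd (n + N) x)"
  by (simp add: block_info_def word_add)

lemma info_eq: "info k = block_info 1 k"
  by (rule ext) (simp add: info_def block_info_def)

lemma block_info_integrable: "integrable M (block_info n N)"
  unfolding block_info_eq by (rule function_of_word_integrable)

lemma block_info_measurable [measurable]: "block_info n N \<in> borel_measurable M"
  using block_info_integrable by (rule borel_measurable_integrable)

lemma info_measurable [measurable]: "info k \<in> borel_measurable M"
  unfolding info_eq by measurable

text \<open>A function of a word of fixed length takes finitely many values. The bound is uniform in
  \<open>x\<close>, as the ergodic theorem above requires.\<close>

lemma info_bounded: "\<exists>B. \<forall>x. \<bar>info k x\<bar> \<le> B"
proof -
  define F where "F = (\<lambda>w. ln (p (drop 1 w)) - ln (p w))"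
  have "\<bar>info k x\<bar> \<le> (\<Sum>w\<in>W (1 + k). \<bar>F w\<bar>)" for x
  proof -
    have "info k x = F (wd (1 + k) x)" by (simp only: info_eq block_info_eq F_def)
    then show ?thesis
      using member_le_sum[of "wd (1 + k) x" "W (1 + k)" "\<lambda>w. \<bar>F w\<bar>"] word_in[of "1 + k" x] finite_W
      by simp
  qed
  then show ?thesis by blast
qed

text \<open>The chain rule for conditional entropy; invariance moves the word starting at time
  \<open>n\<close> back to time 0.\<close>

lemma integral_block_info: "(\<integral>x. block_info n N x \<partial>M) = word_entropy (n + N) - word_entropy N"
proof -
  let ?F = "\<lambda>x. ln (p (wd N x))"
  have "(\<integral>x. ?F ((T ^^ n) x) \<partial>M) = (\<integral>x. ?F x \<partial>M)"
    by (rule integral_comp_iterate) (rule function_of_word_measurable)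
  moreover have "integrable M (\<lambda>x. ?F ((T ^^ n) x))"
    using function_of_word_integrable[of "\<lambda>w. ln (p (drop n w))" "n + N"] by (simp add: word_add)
  moreover have "integrable M (\<lambda>x. ln (p (wd (n + N) x)))" by (rule function_of_word_integrable)
  ultimately show ?thesis
    unfolding block_info_def word_entropy_def by simp
qed

text \<open>Logarithms of the transition probabilities add up along the orbit. Positivity of the
  whole word passes to all subwords, so \<open>exp\<close> and \<open>ln\<close> cancel, and
  \<open>k \<le> N\<close> ensures that every context of length \<open>k\<close> fits into the
  word.\<close>

lemma markov_word:
  assumes "k \<le> N" and "0 < p (wd (n + N) x)"
  shows "markov k n (wd (n + N) x) = exp (- birkhoff_sum T (info k) n x)"
  using assms(2)
proof (induction n arbitrary: x)
  case (Suc n)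
  have w: "wd (Suc n + N) x = l x # wd (n + N) (T x)" by (simp add: word_Suc)
  have t1: "take (Suc k) (wd (Suc n + N) x) = wd (Suc k) x"
    using \<open>k \<le> N\<close> by (intro take_word) simp
  have t2: "take k (wd (n + N) (T x)) = wd k (T x)"
    using \<open>k \<le> N\<close> by (intro take_word) simp
  have pos: "0 < p (wd (n + N) (T x))"
    using Suc.prems p_append_le_right[of "[l x]" "wd (n + N) (T x)"] unfolding w by simp
  have pos1: "0 < p (wd (Suc k) x)"
    using Suc.prems p_append_le_left[of "wd (Suc k) x" "drop (Suc k) (wd (Suc n + N) x)"]
    unfolding t1[symmetric] append_take_drop_id by linarith
  have pos2: "0 < p (wd k (T x))"
    using pos p_append_le_left[of "wd k (T x)" "drop k (wd (n + N) (T x))"]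
    unfolding t2[symmetric] append_take_drop_id by linarith
  have "exp (- info k x) = p (wd (Suc k) x) / p (wd k (T x))"
    using pos1 pos2 by (simp add: info_def exp_diff)
  moreover have "markov k (Suc n) (wd (Suc n + N) x) =
      p (wd (Suc k) x) / p (wd k (T x)) * markov k n (wd (n + N) (T x))"
    unfolding markov.simps t1 unfolding w list.sel t2 ..
  ultimately show ?case
    using Suc.IH[OF pos] by (simp only: birkhoff_sum_Suc minus_add_distrib exp_add)
qed simp

text \<open>The log-likelihood ratio of the Markov approximation against the true conditional
  probability of the first \<open>n\<close> letters.\<close>

definition excess :: "nat \<Rightarrow> nat \<Rightarrow> nat \<Rightarrow> 'a \<Rightarrow> real" where
  "excess k n N x = block_info n N x - birkhoff_sum T (info k) n x"

lemma birkhoff_info_integrable: "integrable M (birkhoff_sum T (info k) n)"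
proof -
  obtain B where "\<And>x. \<bar>info k x\<bar> \<le> B" using info_bounded by blast
  then show ?thesis
    by (intro integrable_const_bound[of _ "real n * B"]) (auto simp: abs_birkhoff_sum_le)
qed

lemma excess_integrable: "integrable M (excess k n N)"
  unfolding excess_def
  by (intro Bochner_Integration.integrable_diff block_info_integrable birkhoff_info_integrable)

lemma integral_excess:
  "(\<integral>x. excess k n N x \<partial>M) =
    word_entropy (n + N) - word_entropy N - real n * (word_entropy (Suc k) - word_entropy k)"
proof -
  obtain B where B: "\<And>x. \<bar>info k x\<bar> \<le> B" using info_bounded by blast
  have "(\<integral>x. info k x \<partial>M) = word_entropy (Suc k) - word_entropy k"
    using integral_block_info[of 1 k] by (simp add: info_eq)
  then have "(\<integral>x. birkhoff_sum T (info k) n x \<partial>M) = real n * (word_entropy (Suc k) - word_entropy k)"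
    using integral_birkhoff_sum[OF info_measurable B] by simp
  moreover have "(\<integral>x. excess k n N x \<partial>M) =
      (\<integral>x. block_info n N x \<partial>M) - (\<integral>x. birkhoff_sum T (info k) n x \<partial>M)"
    unfolding excess_def
    by (rule Bochner_Integration.integral_diff[OF block_info_integrable birkhoff_info_integrable])
  ultimately show ?thesis by (simp add: integral_block_info)
qed

text \<open>The likelihood ratio integrates to at most 1. It is presented through a function
  \<open>F\<close> of the word so that its integral becomes a finite sum.\<close>

lemma exp_excess:
  assumes "k \<le> N"
  obtains F where "AE x in M. exp (excess k n N x) = F (wd (n + N) x)"
    and "(\<integral>x. F (wd (n + N) x) \<partial>M) \<le> 1"
proof
  let ?F = "\<lambda>w. p (drop n w) / p w * markov k n w"
  show "AE x in M. exp (excess k n N x) = ?F (wd (n + N) x)"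
    using AE_p_word_pos[of "n + N"]
  proof eventually_elim
    case (elim x)
    have "0 < p (wd N ((T ^^ n) x))"
      using elim p_append_le_right[of "wd n x" "wd N ((T ^^ n) x)"] by (simp add: word_add)
    moreover have "drop n (wd (n + N) x) = wd N ((T ^^ n) x)" by (simp add: word_add)
    moreover have "exp (excess k n N x) =
        p (wd N ((T ^^ n) x)) / p (wd (n + N) x) * exp (- birkhoff_sum T (info k) n x)"
      using elim calculation(1)
      by (simp add: excess_def block_info_def exp_diff exp_minus divide_inverse)
    ultimately show ?case using elim by (simp add: markov_word[OF assms])
  qed
  \<comment> \<open>The weight \<open>p w\<close> cancels the denominator of \<open>?F w\<close>;
    for a null word the left-hand term is 0.\<close>
  have "(\<integral>x. ?F (wd (n + N) x) \<partial>M) \<le> (\<Sum>w\<in>W (n + N). p (drop n w) * markov k n w)"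
    unfolding integral_function_of_word[of ?F]
    by (intro sum_mono) (auto simp: p_nonneg markov_nonneg)
  also have "\<dots> \<le> 1" by (rule sum_markov_le[OF assms])
  finally show "(\<integral>x. ?F (wd (n + N) x) \<partial>M) \<le> 1" .
qed

text \<open>Gibbs' inequality: apply \<open>1 + u \<le> exp u\<close> to the excess and
  integrate.\<close>

lemma integral_excess_nonpos:
  assumes "k \<le> N"
  shows "(\<integral>x. excess k n N x \<partial>M) \<le> 0"
proof -
  obtain F where F: "AE x in M. exp (excess k n N x) = F (wd (n + N) x)"
    and F1: "(\<integral>x. F (wd (n + N) x) \<partial>M) \<le> 1"
    using exp_excess[OF assms] by blast
  have "(\<integral>x. excess k n N x \<partial>M) \<le> (\<integral>x. F (wd (n + N) x) - 1 \<partial>M)"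
  proof (rule integral_mono_AE)
    show "AE x in M. excess k n N x \<le> F (wd (n + N) x) - 1"
      using F
    proof eventually_elim
      case (elim x)
      then show ?case using exp_ge_add_one_self[of "excess k n N x"] by simp
    qed
  qed (auto intro: excess_integrable function_of_word_integrable)
  also have "\<dots> = (\<integral>x. F (wd (n + N) x) \<partial>M) - 1"
    by (subst Bochner_Integration.integral_diff) (auto simp: function_of_word_integrable prob_space)
  finally show ?thesis using F1 by simp
qed

text \<open>Here \<open>max 0 u \<le> exp u\<close> is used. The bound is independent of
  \<open>n\<close> and \<open>N\<close>, so it is negligible after division by
  \<open>n\<close>.\<close>

lemma integral_pos_part_excess:
  assumes "k \<le> N"
  shows "(\<integral>x. max 0 (excess k n N x) \<partial>M) \<le> 1"
proof -
  obtain F where F: "AE x in M. exp (excess k n N x) = F (wd (n + N) x)"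
    and F1: "(\<integral>x. F (wd (n + N) x) \<partial>M) \<le> 1"
    using exp_excess[OF assms] by blast
  have "(\<integral>x. max 0 (excess k n N x) \<partial>M) \<le> (\<integral>x. F (wd (n + N) x) \<partial>M)"
  proof (rule integral_mono_AE)
    show "AE x in M. max 0 (excess k n N x) \<le> F (wd (n + N) x)"
      using F
    proof eventually_elim
      case (elim x)
      then show ?case using exp_ge_add_one_self[of "excess k n N x"] exp_ge_zero[of "excess k n N x"]
        by linarith
    qed
  qed (auto intro: excess_integrable function_of_word_integrable)
  then show ?thesis using F1 by simp
qed

section \<open>Entropy rate as the limit of conditional entropies\<close>

abbreviation "entropy_step k \<equiv> word_entropy (Suc k) - word_entropy k"

lemma entropy_step_nonneg: "0 \<le> entropy_step k"
proof -
  have "word_entropy k \<le> word_entropy (Suc k)"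
    unfolding word_entropy_def
  proof (rule integral_mono_AE)
    show "AE x in M. - ln (p (wd k x)) \<le> - ln (p (wd (Suc k) x))"
      using AE_p_word_pos[of "Suc k"]
    proof eventually_elim
      case (elim x)
      have "p (wd (Suc k) x) \<le> p (wd k x)"
        using word_add[of T l k 1 x] p_append_le_left[of "wd k x" "wd 1 ((T ^^ k) x)"] by simp
      with elim show ?case by simp
    qed
  qed (rule function_of_word_integrable)+
  then show ?thesis by simp
qed

text \<open>Gibbs' inequality for one letter conditioned on \<open>Suc k\<close> letters, compared
  with the Markov model of order \<open>k\<close>: further conditioning cannot raise
  entropy.\<close>

lemma entropy_step_antimono: "decseq entropy_step"
  unfolding decseq_Suc_iff
proof
  fix k
  show "entropy_step (Suc k) \<le> entropy_step k"
    using integral_excess_nonpos[of k "Suc k" 1] by (simp add: integral_excess)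
qed

definition entropy_rate :: real where
  "entropy_rate = lim entropy_step"

lemma entropy_step_tendsto: "entropy_step \<longlonglongrightarrow> entropy_rate"
proof -
  have "Bseq entropy_step"
  proof (rule decseq_bounded[OF entropy_step_antimono])
    show "\<forall>i. 0 \<le> entropy_step i" by (simp only: entropy_step_nonneg simp_thms)
  qed
  then have "convergent entropy_step"
    using entropy_step_antimono by (auto intro: Bseq_monoseq_convergent decseq_imp_monoseq)
  then show ?thesis unfolding entropy_rate_def by (simp only: convergent_LIMSEQ_iff)
qed

lemma entropy_rate_le: "entropy_rate \<le> entropy_step k"
  by (rule decseq_ge[OF entropy_step_antimono entropy_step_tendsto])

lemma word_entropy_lower: "real n * entropy_rate \<le> word_entropy (n + N) - word_entropy N"
proof (induction n)
  case (Suc n)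
  from Suc entropy_rate_le[of "n + N"] show ?case by (simp add: algebra_simps)
qed simp

lemma word_entropy_upper: "word_entropy (n + N) - word_entropy N \<le> real n * entropy_step N"
  using integral_excess_nonpos[of N N n] by (simp add: integral_excess)

lemma word_entropy_0: "word_entropy 0 = 0"
  by (simp add: word_entropy_def p_Nil)

text \<open>A Cesaro argument linking the limit of the increments to the normalised entropies by
  which partition entropy is defined. The lower bound holds for every \<open>n\<close>; the upper
  bound uses one index \<open>m\<close> whose increment is already close to the limit.\<close>

lemma word_entropy_rate: "(\<lambda>n. word_entropy n / real n) \<longlonglongrightarrow> entropy_rate"
proof (rule LIMSEQ_I)
  fix r :: real assume r: "0 < r"
  have "eventually (\<lambda>k. entropy_step k < entropy_rate + r / 2) sequentially"
    using r by (intro order_tendstoD[OF entropy_step_tendsto]) simp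
  then obtain m where m: "entropy_step m < entropy_rate + r / 2"
    by (auto simp: eventually_sequentially)
  let ?c = "\<bar>word_entropy m\<bar>"
  obtain n0 :: nat where n0: "2 * ?c / r < real n0" using reals_Archimedean2 by blast
  show "\<exists>no. \<forall>n\<ge>no. norm (word_entropy n / real n - entropy_rate) < r"
  proof (intro exI allI impI)
    \<comment> \<open>The bound \<open>m + 1\<close> makes \<open>n\<close> positive and
      \<open>n - m\<close> a genuine difference; \<open>n0\<close> makes
      \<open>word_entropy m / n\<close> smaller than \<open>r / 2\<close> in absolute value.\<close>
    fix n assume n: "max (m + 1) n0 \<le> n"
    then have npos: "0 < real n" by simp
    have low: "real n * entropy_rate \<le> word_entropy n"
      using word_entropy_lower[of n 0] by (simp add: word_entropy_0)
    have "2 * ?c / r < real n" using n0 n by linarith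
    then have c: "?c < real n * (r / 2)" using r by (simp add: field_simps)
    have "word_entropy n - word_entropy m \<le> real (n - m) * entropy_step m"
      using word_entropy_upper[of "n - m" m] n by simp
    also have "\<dots> \<le> real n * entropy_step m"
      using entropy_step_nonneg[of m] by (intro mult_right_mono) simp_all
    also have "\<dots> \<le> real n * (entropy_rate + r / 2)"
      using m by (intro mult_left_mono) simp_all
    finally have "word_entropy n < real n * (entropy_rate + r)"
      using c by (simp add: algebra_simps)
    then show "norm (word_entropy n / real n - entropy_rate) < r"
      using low npos by (simp add: field_simps abs_less_iff)
  qed
qed

end

locale labelled_ergodic = labelled_mps + ergodic_mps
begin

text \<open>The Birkhoff sums of \<open>info k\<close> concentrate by the ergodic theorem. Their mean exceeds that of
  \<open>block_info n N\<close> by little, and by \<open>integral_pos_part_excess\<close> they are almost an upper bound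
  for it, uniformly in \<open>N\<close>; hence the two are close with high probability.\<close>
lemma block_info_lower:
  assumes r: "0 < r" and z: "0 < z"
  shows "\<exists>n0 k. \<forall>n\<ge>n0. \<forall>N\<ge>k. prob {x. block_info n N x < real n * (entropy_rate - r)} \<le> z"
proof -
  have "eventually (\<lambda>k. entropy_step k < entropy_rate + z * r / 8) sequentially"
    using r z by (intro order_tendstoD[OF entropy_step_tendsto]) simp
  \<comment> \<open>With this \<open>k\<close> the variable \<open>?X\<close> below has mean at most
    \<open>1 + n * z * r / 8\<close>. Markov's inequality at level \<open>n * r / 2\<close> gives
    \<open>z / 4 + 2 / (n * r)\<close>, and \<open>n2\<close> makes the last term at most
    \<open>z / 4\<close>.\<close>
  then obtain k where k: "entropy_step k < entropy_rate + z * r / 8"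
    by (auto simp: eventually_sequentially)
  obtain B where B: "\<And>x. \<bar>info k x\<bar> \<le> B" using info_bounded by blast
  have Ei: "(\<integral>x. info k x \<partial>M) = entropy_step k"
    using integral_block_info[of 1 k] by (simp add: info_eq)
  obtain n1 where n1: "\<And>n. n \<ge> n1 \<Longrightarrow>
      prob {x. birkhoff_sum T (info k) n x < real n * (entropy_step k - r / 2)} \<le> z / 2"
    using birkhoff_lower_tail[OF info_measurable B, of "r / 2" "z / 2"] r z by (auto simp: Ei)
  obtain n2 :: nat where n2: "8 / (r * z) < real n2" using reals_Archimedean2 by blast
  show ?thesis
  proof (intro exI allI impI)
    fix n N assume n: "max n1 (max n2 1) \<le> n" and N: "k \<le> N"
    \<comment> \<open>This is the negative part of the excess, written as positive part minus excess
      because the means of these two are controlled.\<close>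
    let ?X = "\<lambda>x. max 0 (excess k n N x) - excess k n N x"
    have iX: "integrable M ?X" using excess_integrable by auto
    have EX: "(\<integral>x. ?X x \<partial>M) \<le> 1 + real n * (z * r / 8)"
    proof -
      have "(\<integral>x. ?X x \<partial>M) = (\<integral>x. max 0 (excess k n N x) \<partial>M) - (\<integral>x. excess k n N x \<partial>M)"
        using excess_integrable by (intro Bochner_Integration.integral_diff) auto
      also have "\<dots> \<le> 1 + real n * (entropy_step k - entropy_rate)"
        using integral_pos_part_excess[OF N, of n] word_entropy_lower[of n N]
        by (simp add: integral_excess algebra_simps)
      also have "\<dots> \<le> 1 + real n * (z * r / 8)"
        using k by (intro add_left_mono mult_left_mono) simp_all
      finally show ?thesis .
    qed
    have npos: "0 < real n" using n by simp
    have A1: "{x. birkhoff_sum T (info k) n x < real n * (entropy_step k - r / 2)} \<in> sets M"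
    proof -
      have "{x \<in> space M. birkhoff_sum T (info k) n x < real n * (entropy_step k - r / 2)} \<in> sets M"
        by measurable
      then show ?thesis by (simp add: space_UNIV)
    qed
    have A2: "{x. real n * (r / 2) \<le> ?X x} \<in> sets M"
    proof -
      have [measurable]: "?X \<in> borel_measurable M" using iX by auto
      have "{x \<in> space M. real n * (r / 2) \<le> ?X x} \<in> sets M" by measurable
      then show ?thesis by (simp add: space_UNIV)
    qed
    have "prob {x. real n * (r / 2) \<le> ?X x} \<le> (\<integral>x. ?X x \<partial>M) / (real n * (r / 2))"
      using integral_Markov_inequality_measure[OF iX, of "{}" "real n * (r / 2)"] npos r
      by (simp add: space_UNIV)
    also have "\<dots> \<le> (1 + real n * (z * r / 8)) / (real n * (r / 2))"
      using EX npos r by (intro divide_right_mono) auto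
    also have "\<dots> \<le> z / 2"
    proof -
      have "8 / (r * z) < real n" using n2 n by linarith
      then have "8 < real n * (r * z)" using r z by (simp add: field_simps)
      then have "1 + real n * (z * r / 8) \<le> z / 2 * (real n * (r / 2))"
        by (simp add: algebra_simps)
      then show ?thesis using npos r by (simp add: pos_divide_le_eq)
    qed
    finally have m2: "prob {x. real n * (r / 2) \<le> ?X x} \<le> z / 2" .
    have "{x. block_info n N x < real n * (entropy_rate - r)} \<subseteq>
        {x. birkhoff_sum T (info k) n x < real n * (entropy_step k - r / 2)} \<union>
        {x. real n * (r / 2) \<le> ?X x}"
    proof (rule subsetI, rule ccontr)
      fix x assume a: "x \<in> {x. block_info n N x < real n * (entropy_rate - r)}"
        and b: "x \<notin> {x. birkhoff_sum T (info k) n x < real n * (entropy_step k - r / 2)} \<union>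
        {x. real n * (r / 2) \<le> ?X x}"
      have "- excess k n N x < real n * (r / 2)" using b by auto
      moreover have "real n * (entropy_rate - r / 2) \<le> real n * (entropy_step k - r / 2)"
        using entropy_rate_le[of k] by (intro mult_left_mono) auto
      ultimately show False
        using a b by (auto simp: excess_def algebra_simps)
    qed
    then have "prob {x. block_info n N x < real n * (entropy_rate - r)} \<le>
        prob ({x. birkhoff_sum T (info k) n x < real n * (entropy_step k - r / 2)} \<union>
        {x. real n * (r / 2) \<le> ?X x})"
      using A1 A2 by (intro finite_measure_mono) auto
    also have "\<dots> \<le> z / 2 + z / 2"
      using measure_Un_le[OF A1 A2] n1[of n] m2 n by simp
    finally show "prob {x. block_info n N x < real n * (entropy_rate - r)} \<le> z" by simp
  qed
qed

end

section \<open>Measures on metric spaces\<close>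

text \<open>The sets that can be squeezed between a closed and an open set with difference of small
  measure contain the open sets and form a \<sigma>-algebra. The outer approximation is carried
  along because complements exchange the two sides.\<close>

lemma inner_regular_closed:
  fixes M :: "'b::metric_space measure"
  assumes "finite_measure M" and borel: "sets M = sets (borel :: 'b measure)" and A: "A \<in> sets M" and e: "0 < e"
  obtains F where "closed F" "F \<subseteq> A" "measure M (A - F) < e"
proof -
  interpret finite_measure M by fact
  have open_sets: "S \<in> sets M" if "open S" for S :: "'b set" using that borel by auto
  have closed_sets: "S \<in> sets M" if "closed S" for S :: "'b set" using that borel by auto
  have approx: "\<exists>n. measure M (\<Union>(range F) - F n) < e"
    if "incseq F" "\<And>n. closed (F n)" "0 < e" for F :: "nat \<Rightarrow> 'b set" and e
  proof -
    have F: "F n \<in> sets M" for n using that closed_sets by blast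
    have UF: "\<Union>(range F) \<in> sets M" using F by blast
    have "(\<lambda>n. measure M (F n)) \<longlonglongrightarrow> measure M (\<Union>(range F))"
      using F \<open>incseq F\<close> by (intro finite_Lim_measure_incseq) auto
    then have "eventually (\<lambda>n. measure M (\<Union>(range F)) - e < measure M (F n)) sequentially"
      using \<open>0 < e\<close> by (intro order_tendstoD) auto
    then obtain n where "measure M (\<Union>(range F)) - e < measure M (F n)"
      by (auto simp: eventually_sequentially)
    moreover have "measure M (\<Union>(range F) - F n) = measure M (\<Union>(range F)) - measure M (F n)"
      by (rule finite_measure_Diff[OF UF F]) blast
    ultimately show ?thesis by (intro exI[of _ n]) simp
  qed
  have "A \<in> sigma_sets UNIV {S. open S}"
    using A borel by (simp add: borel_def sets_measure_of)
  then have "\<forall>e>0. \<exists>F U. closed F \<and> open U \<and> F \<subseteq> A \<and> A \<subseteq> U \<and> measure M (U - F) < e"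
  proof induction
    case (Basic S)
    then have S: "open S" by simp
    show ?case
    \<comment> \<open>The whole space is treated separately: \<open>infdist\<close> to the empty set
      is 0 by convention, so the sets \<open>F n\<close> would be empty.\<close>
    proof (cases "S = UNIV")
      case True
      then show ?thesis by (intro allI impI exI[of _ UNIV]) simp
    next
      case False
      define F where "F n = {x. 1 / real (Suc n) \<le> infdist x (- S)}" for n
      have cl: "closed (F n)" for n
        unfolding F_def by (intro closed_Collect_le continuous_intros)
      have inc: "incseq F"
      proof (rule incseq_SucI)
        fix n
        have "1 / real (Suc (Suc n)) \<le> 1 / real (Suc n)" by (simp add: field_simps)
        then show "F n \<subseteq> F (Suc n)" unfolding F_def by (blast intro: order_trans)
      qed
      have "\<Union>(range F) = S"
      proof
        show "\<Union>(range F) \<subseteq> S"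
        proof
          fix x assume "x \<in> \<Union>(range F)"
          then obtain n where n: "1 / real (Suc n) \<le> infdist x (- S)" by (auto simp: F_def)
          have "(0::real) < 1 / real (Suc n)" by simp
          with n have "infdist x (- S) \<noteq> 0" by linarith
          then show "x \<in> S" by (cases "x \<in> S") simp_all
        qed
        show "S \<subseteq> \<Union>(range F)"
        proof
          fix x assume "x \<in> S"
          then have "infdist x (- S) \<noteq> 0"
            using in_closed_iff_infdist_zero[of "- S" x] S False by (auto simp: closed_def)
          then have "0 < infdist x (- S)" using infdist_nonneg[of x "- S"] by linarith
          then obtain n where "1 / real (Suc n) < infdist x (- S)"
            by (rule nat_approx_posE)
          then show "x \<in> \<Union>(range F)" by (auto simp: F_def intro!: exI[of _ n])
        qed
      qed
      show ?thesis
      proof (intro allI impI)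
        fix e :: real assume "0 < e"
        then obtain n where "measure M (\<Union>(range F) - F n) < e"
          using approx[OF inc cl] by blast
        moreover have "F n \<subseteq> S" using \<open>\<Union>(range F) = S\<close> by blast
        ultimately show "\<exists>F U. closed F \<and> open U \<and> F \<subseteq> S \<and> S \<subseteq> U \<and> measure M (U - F) < e"
          using cl S \<open>\<Union>(range F) = S\<close> by (intro exI[of _ "F n"] exI[of _ S]) simp
      qed
    qed
  next
    case Empty
    show ?case by (rule allI, rule impI, rule exI[of _ "{}"], rule exI[of _ "{}"]) simp
  next
    case (Compl B)
    show ?case
    proof (intro allI impI)
      fix e :: real assume "0 < e"
      then obtain F U where "closed F" "open U" "F \<subseteq> B" "B \<subseteq> U" "measure M (U - F) < e"
        using Compl.IH by (elim allE[of _ e]) auto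
      moreover have "- F - - U = U - F" by blast
      ultimately show "\<exists>F U. closed F \<and> open U \<and> F \<subseteq> UNIV - B \<and> UNIV - B \<subseteq> U \<and> measure M (U - F) < e"
        by (intro exI[of _ "- U"] exI[of _ "- F"]) (auto simp: closed_Compl open_Compl)
    qed
  next
    case (Union B)
    show ?case
    proof (intro allI impI)
      fix e :: real assume e: "0 < e"
      have "0 < e / 2 * (1 / 2) ^ Suc i" for i using e by simp
      then have "\<forall>i. \<exists>F U. closed F \<and> open U \<and> F \<subseteq> B i \<and> B i \<subseteq> U \<and>
          measure M (U - F) < e / 2 * (1 / 2) ^ Suc i"
        using Union.IH by blast
      then obtain F U where FU: "\<And>i. closed (F i)" "\<And>i. open (U i)" "\<And>i. F i \<subseteq> B i"
        "\<And>i. B i \<subseteq> U i" "\<And>i. measure M (U i - F i) < e / 2 * (1 / 2) ^ Suc i"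
        by metis
      \<comment> \<open>An infinite union of closed sets need not be closed, so it is truncated. One
        half of \<open>e\<close> pays for the gaps \<open>U i - F i\<close>, the other half for the
        truncation.\<close>
      define G where "G n = (\<Union>i\<le>n. F i)" for n
      have UG: "\<Union>(range G) = (\<Union>i. F i)" by (auto simp: G_def)
      have clG: "closed (G n)" for n using FU(1) by (auto simp: G_def)
      have incG: "incseq G" unfolding incseq_def G_def by (intro allI impI UN_mono) auto
      obtain n where n: "measure M (\<Union>(range G) - G n) < e / 2"
        using approx[OF incG clG, of "e / 2"] e by auto
      have FM: "F i \<in> sets M" and UM: "U i \<in> sets M" for i
        using FU closed_sets open_sets by auto
      have sums: "(\<lambda>i. e / 2 * (1 / 2) ^ Suc i) sums (e / 2 * 1)"
        by (intro sums_mult power_half_series)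
      have sm: "summable (\<lambda>i. measure M (U i - F i))"
        by (rule summable_comparison_test'[OF sums_summable[OF sums], of 0])
          (use FU(5) in \<open>auto intro: less_imp_le simp del: power_Suc\<close>)
      have "measure M ((\<Union>i. U i) - (\<Union>i. F i)) \<le> measure M (\<Union>i. U i - F i)"
        using FM UM by (intro finite_measure_mono) auto
      also have "\<dots> \<le> (\<Sum>i. measure M (U i - F i))"
        using FM UM by (intro finite_measure_subadditive_countably sm) auto
      also have "\<dots> \<le> e / 2 * 1"
        using suminf_le[OF less_imp_le[OF FU(5)] sm sums_summable[OF sums]] sums_unique[OF sums]
        by simp
      finally have m1: "measure M ((\<Union>i. U i) - (\<Union>i. F i)) \<le> e / 2" by simp
      have GM: "G n \<in> sets M" using clG closed_sets by blast
      have UF: "(\<Union>i. F i) \<in> sets M" and UU: "(\<Union>i. U i) \<in> sets M" using FM UM by auto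
      have "measure M ((\<Union>i. U i) - G n) \<le>
          measure M (((\<Union>i. U i) - (\<Union>i. F i)) \<union> ((\<Union>i. F i) - G n))"
        using GM UF UU by (intro finite_measure_mono) auto
      also have "\<dots> \<le> measure M ((\<Union>i. U i) - (\<Union>i. F i)) + measure M ((\<Union>i. F i) - G n)"
        using GM UF UU by (intro measure_Un_le) auto
      also have "\<dots> < e" using m1 n UG by simp
      finally have "measure M ((\<Union>i. U i) - G n) < e" .
      moreover have "G n \<subseteq> \<Union>(range B)"
        unfolding G_def using FU(3) by (intro UN_least) blast
      moreover have "\<Union>(range B) \<subseteq> (\<Union>i. U i)" by (intro UN_mono FU(4)) simp
      moreover have "open (\<Union>i. U i)" using FU(2) by blast
      ultimately show "\<exists>F U. closed F \<and> open U \<and> F \<subseteq> \<Union> (range B) \<and> \<Union> (range B) \<subseteq> U \<and> measure M (U - F) < e"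
        using clG[of n] by (intro exI[of _ "G n"] exI[of _ "\<Union>i. U i"]) simp
    qed
  qed
  then obtain F U where FU: "closed F" "open U" "F \<subseteq> A" "A \<subseteq> U" "measure M (U - F) < e"
    using e by (elim allE[of _ e]) auto
  have "measure M (A - F) \<le> measure M (U - F)"
    using FU closed_sets open_sets by (intro finite_measure_mono) auto
  with FU show ?thesis by (intro that[of F]) auto
qed

text \<open>The tail unions decrease, and each contains some \<open>B n\<close> with
  \<open>n \<ge> n0\<close>. This serves below to find points that are good for infinitely many
  \<open>N\<close>, and then for infinitely many \<open>n\<close>.\<close>

lemma (in prob_space) prob_limsup_ge:
  assumes B: "\<And>n. B n \<in> events" and c: "\<And>n::nat. n0 \<le> n \<Longrightarrow> c \<le> prob (B n)"
  shows "c \<le> prob (\<Inter>m. \<Union>n\<in>{m..}. B n)"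
proof -
  let ?U = "\<lambda>m. \<Union>n\<in>{m..}. B n"
  have U: "?U m \<in> events" for m using B by auto
  have "(\<lambda>m. prob (?U m)) \<longlonglongrightarrow> prob (\<Inter>m. ?U m)"
  proof (rule finite_Lim_measure_decseq)
    show "range ?U \<subseteq> events" using U by blast
    show "decseq ?U" unfolding decseq_def by (intro allI impI UN_mono) auto
  qed
  moreover have "c \<le> prob (?U m)" for m
  proof -
    have "c \<le> prob (B (max m n0))" by (rule c) simp
    also have "\<dots> \<le> prob (?U m)" using U[of m] by (intro finite_measure_mono UN_upper) auto
    finally show ?thesis .
  qed
  ultimately show ?thesis by (intro LIMSEQ_le_const) auto
qed

section \<open>Separated sets and stable sets\<close>

definition hamming :: "'b list \<Rightarrow> 'b list \<Rightarrow> nat" where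
  "hamming v w = length (filter (\<lambda>(a, b). a \<noteq> b) (zip v w))"

lemma hamming_Cons: "hamming (a # v) (b # w) = (if a = b then 0 else 1) + hamming v w"
  by (simp add: hamming_def)

lemma hamming_word:
  "hamming (word T l n x) (word T l n y) = card {i. i < n \<and> l ((T ^^ i) x) \<noteq> l ((T ^^ i) y)}"
  unfolding hamming_def length_filter_conv_card
  by (intro arg_cong[of _ _ card]) (auto simp: nth_word)

text \<open>The generating function of the Hamming distance factorises over the letters, each factor
  being at most \<open>1 + card L * t\<close>. The letters of \<open>v\<close> need not lie in
  \<open>L\<close>.\<close>

lemma sum_power_hamming:
  fixes t :: real
  assumes L: "finite L" and t: "0 < t" and v: "length v = n"
  shows "(\<Sum>w | set w \<subseteq> L \<and> length w = n. t ^ hamming v w) \<le> (1 + real (card L) * t) ^ n"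
  using v
proof (induction n arbitrary: v)
  case 0
  have "{w. set w \<subseteq> L \<and> length w = 0} = {[]}" by auto
  with 0 show ?case by (simp add: hamming_def)
next
  case (Suc n)
  then obtain a u where v: "v = a # u" and u: "length u = n" by (auto simp: length_Suc_conv)
  have "(\<Sum>b\<in>L. t ^ hamming v (b # w)) \<le> t ^ hamming u w * (1 + real (card L) * t)" for w
  proof -
    have "(\<Sum>b\<in>L. t ^ hamming v (b # w)) = (\<Sum>b\<in>L. t ^ hamming u w * (if a = b then 1 else t))"
      by (intro sum.cong) (auto simp: v hamming_Cons)
    also have "\<dots> = t ^ hamming u w * (\<Sum>b\<in>L. (if a = b then 1 else t))"
      by (simp add: sum_distrib_left)
    also have "(\<Sum>b\<in>L. (if a = b then 1 else t)) \<le> (\<Sum>b\<in>L. (if a = b then 1 else 0) + t)"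
      using t by (intro sum_mono) auto
    also have "\<dots> \<le> 1 + real (card L) * t"
      using L by (simp add: sum.distrib)
    finally show ?thesis using t by (simp add: mult_left_mono)
  qed
  then have "(\<Sum>w | set w \<subseteq> L \<and> length w = Suc n. t ^ hamming v w) \<le>
      (\<Sum>w | set w \<subseteq> L \<and> length w = n. t ^ hamming u w * (1 + real (card L) * t))"
    unfolding sum_lists_Suc by (intro sum_mono)
  also have "\<dots> \<le> (1 + real (card L) * t) ^ n * (1 + real (card L) * t)"
    unfolding sum_distrib_right[symmetric] using t by (intro mult_right_mono Suc.IH u) simp
  finally show ?case by (simp add: mult.commute)
qed

text \<open>A Chernoff bound: each word of the ball contributes at least
  \<open>exp (c * ln t)\<close> to the generating function.\<close>

lemma card_hamming_ball_le:
  fixes t c :: real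
  assumes L: "finite L" and t: "0 < t" "t \<le> 1" and v: "length v = n"
  shows "real (card {w. set w \<subseteq> L \<and> length w = n \<and> real (hamming v w) \<le> c})
    \<le> exp (real n * (real (card L) * t) - c * ln t)"
proof -
  let ?B = "{w. set w \<subseteq> L \<and> length w = n \<and> real (hamming v w) \<le> c}"
  have fin: "finite {w. set w \<subseteq> L \<and> length w = n}" by (rule finite_lists_length_eq[OF L])
  have le: "exp (c * ln t) \<le> t ^ hamming v w" if "w \<in> ?B" for w
  proof -
    have "c * ln t \<le> real (hamming v w) * ln t"
      using that t by (intro mult_right_mono_neg) auto
    also have "exp \<dots> = t ^ hamming v w" using t by (simp add: exp_of_nat_mult)
    finally show ?thesis by simp
  qed
  have "real (card ?B) * exp (c * ln t) = (\<Sum>w\<in>?B. exp (c * ln t))" by simp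
  also have "\<dots> \<le> (\<Sum>w\<in>?B. t ^ hamming v w)" by (intro sum_mono le)
  also have "\<dots> \<le> (\<Sum>w | set w \<subseteq> L \<and> length w = n. t ^ hamming v w)"
    using fin t by (intro sum_mono2) auto
  also have "\<dots> \<le> (1 + real (card L) * t) ^ n" by (rule sum_power_hamming[OF L t(1) v])
  also have "\<dots> \<le> exp (real (card L) * t) ^ n"
    using t by (intro power_mono exp_ge_add_one_self) simp
  also have "\<dots> = exp (real n * (real (card L) * t))" by (simp add: exp_of_nat_mult)
  finally show ?thesis by (simp add: exp_diff field_simps)
qed

lemma finite_separated_net:
  assumes "finite Z" and refl: "\<And>z. R z z" and sym: "\<And>y z. R y z \<Longrightarrow> R z y"
  shows "\<exists>E\<subseteq>Z. (\<forall>x\<in>E. \<forall>y\<in>E. x \<noteq> y \<longrightarrow> \<not> R x y) \<and> (\<forall>z\<in>Z. \<exists>e\<in>E. R e z)"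
  using \<open>finite Z\<close>
proof induction
  case (insert z Z)
  then obtain E where E: "E \<subseteq> Z" "\<forall>x\<in>E. \<forall>y\<in>E. x \<noteq> y \<longrightarrow> \<not> R x y" "\<forall>z\<in>Z. \<exists>e\<in>E. R e z"
    by blast
  show ?case
  proof (cases "\<exists>e\<in>E. R e z")
    case True
    with E show ?thesis by (intro exI[of _ E]) auto
  next
    case False
    then have "\<not> R z e" if "e \<in> E" for e using that sym by blast
    with False E refl show ?thesis by (intro exI[of _ "insert z E"]) auto
  qed
qed simp

section \<open>Bowen distance and limits of separated sets\<close>

lemma bowen_dist_commute: "bowen_dist T n x y = bowen_dist T n y x"
  by (simp add: bowen_dist_def dist_commute)

lemma dist_le_bowen_dist: "i < n \<Longrightarrow> dist ((T ^^ i) x) ((T ^^ i) y) \<le> bowen_dist T n x y"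
  unfolding bowen_dist_def by (intro Max_ge) auto

lemma bowen_dist_less_iff:
  "0 < n \<Longrightarrow> bowen_dist T n x y < d \<longleftrightarrow> (\<forall>i<n. dist ((T ^^ i) x) ((T ^^ i) y) < d)"
  unfolding bowen_dist_def by (subst Max_less_iff) auto

lemma bowen_dist_refl: "0 < n \<Longrightarrow> bowen_dist T n x x = 0"
  unfolding bowen_dist_def by (simp add: image_constant_conv lessThan_empty_iff)

lemma continuous_on_funpow:
  fixes T :: "'a::topological_space \<Rightarrow> 'a"
  assumes "continuous_on UNIV T"
  shows "continuous_on UNIV (T ^^ n)"
proof (induction n)
  case (Suc n)
  then show ?case
    using continuous_on_compose2[OF assms Suc] by (simp add: comp_def)
qed (simp add: id_def)

lemma tendsto_funpow:
  fixes T :: "'a::topological_space \<Rightarrow> 'a"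
  assumes "continuous_on UNIV T" and "(u \<longlongrightarrow> y) F"
  shows "((\<lambda>i. (T ^^ n) (u i)) \<longlongrightarrow> (T ^^ n) y) F"
  using continuous_on_tendsto_compose[OF continuous_on_funpow[OF assms(1)] assms(2)] by simp

lemma finite_family_convergent_subseq:
  fixes z :: "nat \<Rightarrow> nat \<Rightarrow> 'a::metric_space"
  assumes "compact (UNIV :: 'a set)"
  shows "\<exists>r y. strict_mono r \<and> (\<forall>j<m. (\<lambda>i. z (r i) j) \<longlonglongrightarrow> y j)"
proof (induction m)
  case 0
  show ?case by (intro exI[of _ id]) (simp add: strict_mono_def)
next
  case (Suc m)
  then obtain r y where r: "strict_mono (r :: nat \<Rightarrow> nat)" and y: "\<And>j. j < m \<Longrightarrow> (\<lambda>i. z (r i) j) \<longlonglongrightarrow> y j"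
    by blast
  have "seq_compact (UNIV :: 'a set)" using assms by (rule compact_imp_seq_compact)
  then obtain a s where s: "strict_mono (s :: nat \<Rightarrow> nat)" and a: "((\<lambda>i. z (r i) m) \<circ> s) \<longlonglongrightarrow> a"
    unfolding seq_compact_def by blast
  have "(\<lambda>i. z ((r \<circ> s) i) j) \<longlonglongrightarrow> (y(m := a)) j" if "j < Suc m" for j
  proof (cases "j = m")
    case True
    with a show ?thesis by (simp add: comp_def)
  next
    case False
    with that have "((\<lambda>i. z (r i) j) \<circ> s) \<longlonglongrightarrow> y j"
      by (intro LIMSEQ_subseq_LIMSEQ[OF y s]) simp
    with False show ?thesis by (simp add: comp_def)
  qed
  then show ?case
    using strict_mono_o[OF r s] by blast
qed

text \<open>For fixed \<open>n\<close> a fixed number of points is followed along a convergent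
  subsequence as the horizon \<open>N\<close> grows. Non-strict conditions pass to the limit by
  continuity; strict separation by \<open>d\<close> becomes separation by at least \<open>d\<close>,
  whence the strict bound with \<open>d / 2\<close>.\<close>

lemma separated_points_limit:
  fixes T :: "'a::metric_space \<Rightarrow> 'a"
  assumes cpt: "compact (UNIV :: 'a set)" and T: "continuous_on UNIV T"
    and f: "continuous_on UNIV f" and n: "0 < n" and d: "0 < d"
    and E: "\<And>i::nat. \<exists>N\<ge>i. \<exists>E. finite E \<and> c \<le> real (card E)
      \<and> (\<forall>x\<in>E. \<forall>y\<in>E. x \<noteq> y \<longrightarrow> d < bowen_dist T n x y)
      \<and> (\<forall>z\<in>E. s \<le> birkhoff_sum T f n z)
      \<and> (\<forall>z\<in>E. \<forall>j<N. dist ((T ^^ j) x) ((T ^^ j) ((T ^^ n) z)) \<le> \<epsilon>)"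
  shows "ereal (c * exp s) \<le> Pn T f n (d / 2) ((T ^^ n) -` stable_set T \<epsilon> x)"
proof -
  \<comment> \<open>The number of points must not depend on \<open>N\<close>, so only
    \<open>m\<close> points are kept from each set \<open>E\<close>.\<close>
  define m where "m = nat \<lceil>c\<rceil>"
  define Q where "Q i u \<longleftrightarrow> (\<forall>a<m. \<forall>b<m. a \<noteq> b \<longrightarrow> d < bowen_dist T n (u a) (u b)) \<and>
      (\<forall>a<m. s \<le> birkhoff_sum T f n (u a)) \<and>
      (\<forall>a<m. \<forall>j<i. dist ((T ^^ j) x) ((T ^^ j) ((T ^^ n) (u a))) \<le> \<epsilon>)" for i :: nat and u
  have "\<forall>i. \<exists>u. Q i u"
  proof
    fix i
    obtain N E where NE: "i \<le> N" "finite E" "c \<le> real (card E)"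
      "\<forall>x\<in>E. \<forall>y\<in>E. x \<noteq> y \<longrightarrow> d < bowen_dist T n x y" "\<forall>z\<in>E. s \<le> birkhoff_sum T f n z"
      "\<forall>z\<in>E. \<forall>j<N. dist ((T ^^ j) x) ((T ^^ j) ((T ^^ n) z)) \<le> \<epsilon>"
      using E[of i] by (elim exE conjE) (rule that)
    have "m \<le> card E" using NE(3) unfolding m_def by linarith
    obtain u where u: "bij_betw u {..<card E} E"
      using ex_bij_betw_nat_finite[OF NE(2)] by (auto simp: atLeast0LessThan)
    have uE: "u a \<in> E" if "a < m" for a
      using that \<open>m \<le> card E\<close> u by (auto simp: bij_betw_def)
    have "u a \<noteq> u b" if "a < m" "b < m" "a \<noteq> b" for a b
      using u \<open>m \<le> card E\<close> that by (auto simp: bij_betw_def inj_on_def)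
    then have "Q i u" unfolding Q_def using uE NE by auto
    then show "\<exists>u. Q i u" by blast
  qed
  then obtain z where "\<And>i. Q i (z i)" by metis
  then have z: "\<And>i a b. a < m \<Longrightarrow> b < m \<Longrightarrow> a \<noteq> b \<Longrightarrow> d < bowen_dist T n (z i a) (z i b)"
    "\<And>i a. a < m \<Longrightarrow> s \<le> birkhoff_sum T f n (z i a)"
    "\<And>i a j. a < m \<Longrightarrow> j < i \<Longrightarrow> dist ((T ^^ j) x) ((T ^^ j) ((T ^^ n) (z i a))) \<le> \<epsilon>"
    unfolding Q_def by blast+
  obtain r y where r: "strict_mono (r :: nat \<Rightarrow> nat)"
    and y: "\<And>a. a < m \<Longrightarrow> (\<lambda>i. z (r i) a) \<longlonglongrightarrow> y a"
    using finite_family_convergent_subseq[OF cpt, of m z] by blast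
  have sep: "d \<le> bowen_dist T n (y a) (y b)" if "a < m" "b < m" "a \<noteq> b" for a b
  proof (rule ccontr)
    assume "\<not> d \<le> bowen_dist T n (y a) (y b)"
    then have "\<forall>i<n. dist ((T ^^ i) (y a)) ((T ^^ i) (y b)) < d"
      using bowen_dist_less_iff[OF n, of T "y a" "y b" d] by simp
    then have "\<forall>i\<in>{..<n}. eventually (\<lambda>k. dist ((T ^^ i) (z (r k) a)) ((T ^^ i) (z (r k) b)) < d) sequentially"
      using that y by (auto intro!: order_tendstoD tendsto_dist tendsto_funpow[OF T])
    then have "eventually (\<lambda>k. \<forall>i\<in>{..<n}. dist ((T ^^ i) (z (r k) a)) ((T ^^ i) (z (r k) b)) < d) sequentially"
      by (intro eventually_ball_finite) auto
    then obtain k where "\<forall>i<n. dist ((T ^^ i) (z (r k) a)) ((T ^^ i) (z (r k) b)) < d"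
      by (auto simp: eventually_sequentially)
    then show False
      using z(1)[OF that, of "r k"] bowen_dist_less_iff[OF n, of T "z (r k) a" "z (r k) b" d]
      by simp
  qed
  have sum: "s \<le> birkhoff_sum T f n (y a)" if "a < m" for a
  proof (rule LIMSEQ_le_const)
    show "(\<lambda>k. birkhoff_sum T f n (z (r k) a)) \<longlonglongrightarrow> birkhoff_sum T f n (y a)"
      unfolding birkhoff_sum_def
      by (intro tendsto_sum continuous_on_tendsto_compose[OF f] tendsto_funpow[OF T] y that) auto
  qed (use z(2) that in auto)
  have stable: "(T ^^ n) (y a) \<in> stable_set T \<epsilon> x" if "a < m" for a
    unfolding stable_set_def
  proof (intro CollectI allI)
    fix j
    have "(\<lambda>k. dist ((T ^^ j) x) ((T ^^ j) ((T ^^ n) (z (r k) a)))) \<longlonglongrightarrow>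
        dist ((T ^^ j) x) ((T ^^ j) ((T ^^ n) (y a)))"
      by (intro tendsto_dist tendsto_const tendsto_funpow[OF T] y that)
    \<comment> \<open>Along the subsequence \<open>r k \<ge> k > j\<close>, so time \<open>j\<close>
      lies within the horizon for all late \<open>k\<close>.\<close>
    moreover have "\<forall>k\<ge>Suc j. dist ((T ^^ j) x) ((T ^^ j) ((T ^^ n) (z (r k) a))) \<le> \<epsilon>"
      using z(3)[OF that] seq_suble[OF r] by (meson Suc_le_lessD less_le_trans)
    ultimately show "dist ((T ^^ j) x) ((T ^^ j) ((T ^^ n) (y a))) \<le> \<epsilon>"
      by (intro LIMSEQ_le_const2) auto
  qed
  have inj: "inj_on y {..<m}"
  proof (rule inj_onI, rule ccontr)
    fix a b assume "a \<in> {..<m}" "b \<in> {..<m}" "y a = y b" "a \<noteq> b"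
    then show False using sep[of a b] bowen_dist_refl[OF n, of T "y b"] d by simp
  qed
  have "c * exp s \<le> real m * exp s"
    by (intro mult_right_mono) (auto simp: m_def le_of_int_ceiling intro: order_trans[OF le_of_int_ceiling])
  also have "\<dots> = (\<Sum>a<m. exp s)" by simp
  also have "\<dots> \<le> (\<Sum>a<m. exp (birkhoff_sum T f n (y a)))"
    using sum by (intro sum_mono) simp
  also have "\<dots> = (\<Sum>w\<in>y ` {..<m}. exp (birkhoff_sum T f n w))"
    by (simp add: sum.reindex[OF inj])
  finally have "ereal (c * exp s) \<le> ereal (\<Sum>w\<in>y ` {..<m}. exp (birkhoff_sum T f n w))" by simp
  also have "\<dots> \<le> Pn T f n (d / 2) ((T ^^ n) -` stable_set T \<epsilon> x)"
    unfolding Pn_def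
  proof (rule Sup_upper, rule CollectI, rule exI[of _ "y ` {..<m}"], intro conjI refl ballI impI)
    show "y ` {..<m} \<subseteq> (T ^^ n) -` stable_set T \<epsilon> x" using stable by auto
    fix u v assume "u \<in> y ` {..<m}" "v \<in> y ` {..<m}" "u \<noteq> v"
    then obtain a b where "a < m" "b < m" "a \<noteq> b" "u = y a" "v = y b" by auto
    then show "d / 2 < bowen_dist T n u v" using sep[of a b] d by simp
  qed simp
  finally show ?thesis .
qed

section \<open>Monotonicity of the pressure in its scales\<close>

lemma eln_mono: "a \<le> b \<Longrightarrow> eln a \<le> eln b"
  by (cases a; cases b) (auto simp: eln_def)

lemma Pn_mono: "K \<subseteq> K' \<Longrightarrow> d' \<le> d \<Longrightarrow> Pn T f n d K \<le> Pn T f n d' K'"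
  unfolding Pn_def by (rule Sup_subset_mono) (auto 0 4 intro: le_less_trans)

lemma tendsto_at_right_antimono:
  fixes g :: "real \<Rightarrow> ereal"
  assumes "\<And>a b. 0 < a \<Longrightarrow> a \<le> b \<Longrightarrow> g b \<le> g a"
  shows "(g \<longlongrightarrow> (SUP d\<in>{0<..}. g d)) (at_right 0)"
proof (rule increasing_tendsto)
  show "eventually (\<lambda>d. g d \<le> (SUP d\<in>{0<..}. g d)) (at_right 0)"
    unfolding eventually_at_right_field by (intro exI[of _ 1]) (auto intro: SUP_upper)
  fix x assume "x < (SUP d\<in>{0<..}. g d)"
  then obtain d where d: "0 < d" "x < g d" by (auto simp: less_SUP_iff)
  then show "eventually (\<lambda>d. x < g d) (at_right 0)"
    unfolding eventually_at_right_field
    using d(1) by (intro exI[of _ d]) (auto intro!: less_le_trans[OF d(2)] assms)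
qed

lemma tendsto_at_right_mono:
  fixes g :: "real \<Rightarrow> ereal"
  assumes "\<And>a b. 0 < a \<Longrightarrow> a \<le> b \<Longrightarrow> g a \<le> g b"
  shows "(g \<longlongrightarrow> (INF d\<in>{0<..}. g d)) (at_right 0)"
proof (rule decreasing_tendsto)
  show "eventually (\<lambda>d. (INF d\<in>{0<..}. g d) \<le> g d) (at_right 0)"
    unfolding eventually_at_right_field by (intro exI[of _ 1]) (auto intro: INF_lower)
  fix x assume "(INF d\<in>{0<..}. g d) < x"
  then obtain d where d: "0 < d" "g d < x" by (auto simp: INF_less_iff)
  then show "eventually (\<lambda>d. g d < x) (at_right 0)"
    unfolding eventually_at_right_field
    using d(1) by (intro exI[of _ d]) (auto intro!: le_less_trans[OF _ d(2)] assms)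
qed

definition stable_growth :: "('a::metric_space \<Rightarrow> 'a) \<Rightarrow> ('a \<Rightarrow> real) \<Rightarrow> 'a \<Rightarrow> real \<Rightarrow> real \<Rightarrow> ereal" where
  "stable_growth T f x \<epsilon> d =
     limsup (\<lambda>n. ereal (1 / real n) * eln (Pn T f n d ((T ^^ n) -` stable_set T \<epsilon> x)))"

lemma stable_growth_mono:
  assumes "\<epsilon> \<le> \<epsilon>'" and "d' \<le> d"
  shows "stable_growth T f x \<epsilon> d \<le> stable_growth T f x \<epsilon>' d'"
proof -
  have "stable_set T \<epsilon> x \<subseteq> stable_set T \<epsilon>' x"
    using assms(1) by (auto simp: stable_set_def intro: order_trans)
  then have "eln (Pn T f n d ((T ^^ n) -` stable_set T \<epsilon> x)) \<le>
      eln (Pn T f n d' ((T ^^ n) -` stable_set T \<epsilon>' x))" for n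
    using assms(2) by (intro eln_mono Pn_mono vimage_mono)
  then show ?thesis
    unfolding stable_growth_def
    by (intro Limsup_mono always_eventually allI ereal_mult_left_mono) simp_all
qed

text \<open>The growth rate can only increase as \<open>d\<close> decreases, so the limit in
  \<open>Ps\<close> exists and is a supremum. A bound at one scale \<open>d\<close> therefore bounds
  \<open>Ps\<close> from below.\<close>

lemma Ps_eq_SUP: "Ps T f x \<epsilon> = (SUP d\<in>{0<..}. stable_growth T f x \<epsilon> d)"
  unfolding Ps_def stable_growth_def[symmetric]
proof (rule tendsto_Lim)
  show "(stable_growth T f x \<epsilon> \<longlongrightarrow> (SUP d\<in>{0<..}. stable_growth T f x \<epsilon> d)) (at_right 0)"
    by (rule tendsto_at_right_antimono) (simp add: stable_growth_mono)
qed simp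

lemma Ps_mono: "\<epsilon> \<le> \<epsilon>' \<Longrightarrow> Ps T f x \<epsilon> \<le> Ps T f x \<epsilon>'"
  unfolding Ps_eq_SUP by (intro SUP_mono') (simp add: stable_growth_mono)

lemma Lim_Ps: "Lim (at_right 0) (\<lambda>\<epsilon>. Ps T f x \<epsilon>) = (INF \<epsilon>\<in>{0<..}. Ps T f x \<epsilon>)"
proof (rule tendsto_Lim)
  show "(Ps T f x \<longlongrightarrow> (INF \<epsilon>\<in>{0<..}. Ps T f x \<epsilon>)) (at_right 0)"
    by (rule tendsto_at_right_mono) (simp add: Ps_mono)
qed simp

text \<open>One scale \<open>d\<close> and infinitely many \<open>n\<close> suffice, since
  \<open>Ps\<close> is a supremum over scales of upper limits.\<close>

lemma Ps_ge:
  assumes "0 < d" and "\<And>i::nat. \<exists>n\<ge>i. 0 < n \<and>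
      ereal (exp (real n * c)) \<le> Pn T f n d ((T ^^ n) -` stable_set T \<epsilon> x)"
  shows "ereal c \<le> Ps T f x \<epsilon>"
proof -
  let ?g = "\<lambda>n. ereal (1 / real n) * eln (Pn T f n d ((T ^^ n) -` stable_set T \<epsilon> x))"
  have "ereal c \<le> limsup ?g"
  proof (rule ccontr)
    assume "\<not> ereal c \<le> limsup ?g"
    then have "limsup ?g < ereal c" by simp
    then have "eventually (\<lambda>n. ?g n < ereal c) sequentially" by (rule Limsup_lessD)
    then obtain i where i: "\<And>n. n \<ge> i \<Longrightarrow> ?g n < ereal c" by (auto simp: eventually_sequentially)
    obtain n where n: "i \<le> n" "0 < n"
      and le: "ereal (exp (real n * c)) \<le> Pn T f n d ((T ^^ n) -` stable_set T \<epsilon> x)"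
      using assms(2) by blast
    have "ereal c = ereal (1 / real n) * ereal (real n * c)" using n by simp
    also have "\<dots> = ereal (1 / real n) * eln (ereal (exp (real n * c)))" by (simp add: eln_def)
    also have "\<dots> \<le> ?g n" by (intro ereal_mult_left_mono eln_mono le) simp
    finally show False using i[OF n(1)] by simp
  qed
  also have "\<dots> \<le> Ps T f x \<epsilon>"
    unfolding Ps_eq_SUP stable_growth_def[symmetric] using assms(1) by (intro SUP_upper) simp
  finally show ?thesis .
qed

section \<open>Many separated points in a fibre\<close>

context labelled_mps
begin

lemma word_event [measurable]: "{x. Q (wd n x)} \<in> events"
  and prob_word_event: "prob {x. Q (wd n x)} = (\<Sum>w\<in>W n. p w * of_bool (Q w))"
proof -
  have eq: "{x. Q (wd n x)} = {x \<in> space M. (\<lambda>w. of_bool (Q w) :: real) (wd n x) = 1}"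
    by (auto simp: space_UNIV)
  show *: "{x. Q (wd n x)} \<in> events"
    unfolding eq using function_of_word_measurable[of "\<lambda>w. of_bool (Q w)" n] by measurable
  have "(\<lambda>x. of_bool (Q (wd n x)) :: real) = indicator {x. Q (wd n x)}"
    by (auto split: split_indicator)
  then show "prob {x. Q (wd n x)} = (\<Sum>w\<in>W n. p w * of_bool (Q w))"
    using integral_function_of_word[of "\<lambda>w. of_bool (Q w)" n] * by simp
qed

text \<open>The fibres over the \<open>N\<close>-cylinders partition the space and have measure
  \<open>p w\<close>. In a fibre of which \<open>G\<close> fills less than half, the complement of
  \<open>G\<close> fills more than half, so such fibres have total measure at most twice that of the
  complement.\<close>

lemma prob_large_fibre:
  assumes G: "G \<in> events" and z: "1 - z \<le> prob G"
  shows "1 - 2 * z \<le> prob {x. 0 < p (wd N x) \<and>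
    p (wd N x) / 2 \<le> prob (G \<inter> (T ^^ n) -` cyl (wd N x))}"
proof -
  define C where "C w = (T ^^ n) -` cyl w" for w
  have C: "C w \<in> events" for w
    using measurable_sets[OF iterate_measurable cyl_sets, of n w] by (simp add: C_def space_UNIV)
  have pC: "prob (C w) = p w" for w
    unfolding C_def p_def by (rule prob_vimage_iterate[OF cyl_sets])
  define Q where "Q w \<longleftrightarrow> 0 < p w \<and> p w / 2 \<le> prob (G \<inter> C w)" for w
  have p_split: "p w = prob (G \<inter> C w) + prob (- G \<inter> C w)" for w
  proof -
    have "prob ((G \<inter> C w) \<union> (- G \<inter> C w)) = prob (G \<inter> C w) + prob (- G \<inter> C w)"
      using G C[of w] by (intro finite_measure_Union) auto
    moreover have "(G \<inter> C w) \<union> (- G \<inter> C w) = C w" by blast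
    ultimately show ?thesis by (simp add: pC)
  qed
  have "p w * of_bool (\<not> Q w) \<le> 2 * prob (- G \<inter> C w)" for w
  proof (cases "Q w")
    case False
    then have "p w \<le> 0 \<or> prob (G \<inter> C w) < p w / 2" by (auto simp: Q_def)
    then have "p w \<le> 2 * prob (- G \<inter> C w)"
      using p_split[of w] measure_nonneg[of M "- G \<inter> C w"] by linarith
    then show ?thesis using False by simp
  qed simp
  then have "prob {x. \<not> Q (wd N x)} \<le> (\<Sum>w\<in>W N. 2 * prob (- G \<inter> C w))"
    unfolding prob_word_event[of "\<lambda>w. \<not> Q w" N] by (intro sum_mono)
  also have "\<dots> = 2 * prob (\<Union>w\<in>W N. - G \<inter> C w)"
  proof -
    have "prob (\<Union>w\<in>W N. - G \<inter> C w) = (\<Sum>w\<in>W N. prob (- G \<inter> C w))"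
    proof (rule finite_measure_finite_Union[OF finite_W])
      have "- G \<inter> C w \<in> events" for w using Compl_sets[OF G] C[of w] by (rule sets.Int)
      then show "(\<lambda>w. - G \<inter> C w) ` W N \<subseteq> events" by blast
      show "disjoint_family_on (\<lambda>w. - G \<inter> C w) (W N)"
        by (auto simp: disjoint_family_on_def C_def cyl_def)
    qed
    then show ?thesis by (simp add: sum_distrib_left)
  qed
  also have "\<dots> \<le> 2 * prob (- G)"
    using G by (intro mult_left_mono finite_measure_mono) auto
  also have "\<dots> \<le> 2 * z" using z prob_Compl[OF G] by simp
  finally have "prob {x. \<not> Q (wd N x)} \<le> 2 * z" .
  moreover have "{x. \<not> Q (wd N x)} = - {x. Q (wd N x)}" by auto
  ultimately have "1 - 2 * z \<le> prob {x. Q (wd N x)}"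
    using prob_Compl[OF word_event, of Q N] by simp
  then show ?thesis by (simp add: Q_def C_def)
qed

text \<open>The cylinders of the words \<open>v @ w\<close> cover \<open>D\<close>. Each has measure
  at most \<open>exp (- (n * a)) * p w\<close>, while \<open>D\<close> has at least
  \<open>p w / 2\<close>, so many of them are required.\<close>

lemma card_words_lower:
  assumes D: "D \<in> events" "D \<subseteq> (T ^^ n) -` cyl w" and w: "length w = N" "0 < p w"
    and info: "\<And>z. z \<in> D \<Longrightarrow> 0 < p (wd (n + N) z) \<and> real n * a \<le> block_info n N z"
    and large: "p w / 2 \<le> prob D"
  shows "exp (real n * a) / 2 \<le> real (card (wd n ` D))"
proof -
  let ?V = "wd n ` D"
  have fin: "finite ?V" using word_in by (intro finite_subset[OF _ finite_W[of n]]) auto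
  have word: "wd (n + N) z = wd n z @ w" if "z \<in> D" for z
    using that D w by (auto simp: word_add cyl_def)
  have small: "p (v @ w) \<le> exp (- (real n * a)) * p w" if "v \<in> ?V" for v
  proof -
    obtain z where z: "z \<in> D" "v = wd n z" using \<open>v \<in> ?V\<close> by auto
    have "wd N ((T ^^ n) z) = w" using z D w by (auto simp: cyl_def)
    with info[OF z(1)] have pos: "0 < p (v @ w)" and "real n * a \<le> ln (p w) - ln (p (v @ w))"
      using word[OF z(1)] z(2) by (auto simp: block_info_def)
    then have "ln (p (v @ w)) \<le> - (real n * a) + ln (p w)" by simp
    then have "exp (ln (p (v @ w))) \<le> exp (- (real n * a) + ln (p w))" by simp
    then show ?thesis using pos w by (simp add: exp_diff exp_minus field_simps)
  qed
  have "prob D \<le> prob (\<Union>v\<in>?V. cyl (v @ w))"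
  proof (rule finite_measure_mono)
    show "D \<subseteq> (\<Union>v\<in>?V. cyl (v @ w))"
    proof
      fix z assume "z \<in> D"
      then have "z \<in> cyl (wd n z @ w)" using word w by (simp add: cyl_def)
      then show "z \<in> (\<Union>v\<in>?V. cyl (v @ w))" using \<open>z \<in> D\<close> by blast
    qed
    show "(\<Union>v\<in>?V. cyl (v @ w)) \<in> events" by (intro sets.finite_UN fin cyl_sets)
  qed
  also have "\<dots> \<le> (\<Sum>v\<in>?V. p (v @ w))"
    unfolding p_def by (intro finite_measure_subadditive_finite fin image_subsetI cyl_sets)
  also have "\<dots> \<le> (\<Sum>v\<in>?V. exp (- (real n * a)) * p w)" by (intro sum_mono small)
  finally have "p w / 2 \<le> real (card ?V) * exp (- (real n * a)) * p w" using large by simp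
  then have "1 / 2 \<le> real (card ?V) * exp (- (real n * a))" using w by (simp add: field_simps)
  then show ?thesis by (simp add: exp_minus field_simps)
qed

end

text \<open>Two points within Bowen distance \<open>d\<close> can have different letters only at
  times when one of them visits \<open>B\<close>, hence at most \<open>2 * n * \<kappa>\<close>
  times. As \<open>Z\<close> has one point per word, the Hamming bound limits how many points of
  \<open>Z\<close> lie near one point of a maximal separated set.\<close>

lemma separated_subset_card:
  fixes T :: "'a::metric_space \<Rightarrow> 'a" and t \<kappa> d :: real
  assumes L: "finite L" "\<And>x. l x \<in> L" and t: "0 < t" "t \<le> 1" and n: "0 < n" and d: "0 \<le> d"
    and sep: "\<And>x y. x \<notin> B \<Longrightarrow> y \<notin> B \<Longrightarrow> dist x y \<le> d \<Longrightarrow> l x = l y"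
    and Z: "finite Z" "inj_on (word T l n) Z"
    and rare: "\<And>z. z \<in> Z \<Longrightarrow> real (card {i. i < n \<and> (T ^^ i) z \<in> B}) \<le> real n * \<kappa>"
  shows "\<exists>E\<subseteq>Z. (\<forall>x\<in>E. \<forall>y\<in>E. x \<noteq> y \<longrightarrow> d < bowen_dist T n x y) \<and>
    real (card Z) \<le> real (card E) * exp (real n * (real (card L) * t - 2 * \<kappa> * ln t))"
proof -
  let ?w = "word T l n"
  let ?e = "exp (real n * (real (card L) * t - 2 * \<kappa> * ln t))"
  obtain E where E: "E \<subseteq> Z" "\<forall>x\<in>E. \<forall>y\<in>E. x \<noteq> y \<longrightarrow> \<not> bowen_dist T n x y \<le> d"
    "\<forall>z\<in>Z. \<exists>e\<in>E. bowen_dist T n e z \<le> d"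
    using finite_separated_net[OF Z(1), of "\<lambda>x y. bowen_dist T n x y \<le> d"] bowen_dist_refl[OF n, of T] d
    by (auto simp: bowen_dist_commute)
  have ball: "real (card {z \<in> Z. bowen_dist T n e z \<le> d}) \<le> ?e" if "e \<in> E" for e
  proof -
    let ?H = "{u. set u \<subseteq> L \<and> length u = n \<and> real (hamming (?w e) u) \<le> 2 * real n * \<kappa>}"
    have "?w z \<in> ?H" if "z \<in> Z" "bowen_dist T n e z \<le> d" for z
    proof -
      have "{i. i < n \<and> l ((T ^^ i) e) \<noteq> l ((T ^^ i) z)} \<subseteq>
          {i. i < n \<and> (T ^^ i) e \<in> B} \<union> {i. i < n \<and> (T ^^ i) z \<in> B}"
        using sep dist_le_bowen_dist[of _ n T e z] that(2) order_trans by blast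
      then have "hamming (?w e) (?w z) \<le>
          card ({i. i < n \<and> (T ^^ i) e \<in> B} \<union> {i. i < n \<and> (T ^^ i) z \<in> B})"
        unfolding hamming_word by (intro card_mono) auto
      also have "\<dots> \<le> card {i. i < n \<and> (T ^^ i) e \<in> B} + card {i. i < n \<and> (T ^^ i) z \<in> B}"
        by (rule card_Un_le)
      finally have "real (hamming (?w e) (?w z)) \<le> 2 * real n * \<kappa>"
        using rare[of e] rare[of z] \<open>e \<in> E\<close> E(1) that by auto
      then show ?thesis using L(2) by (auto simp: word_def)
    qed
    then have sub: "?w ` {z \<in> Z. bowen_dist T n e z \<le> d} \<subseteq> ?H" by auto
    have finH: "finite ?H"
      by (rule finite_subset[OF _ finite_lists_length_eq[OF L(1), of n]]) auto
    have "card {z \<in> Z. bowen_dist T n e z \<le> d} = card (?w ` {z \<in> Z. bowen_dist T n e z \<le> d})"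
      by (rule card_image[symmetric]) (use Z(2) in \<open>auto simp: inj_on_def\<close>)
    also have "\<dots> \<le> card ?H" by (rule card_mono[OF finH sub])
    finally have "real (card {z \<in> Z. bowen_dist T n e z \<le> d}) \<le> real (card ?H)" by simp
    also have "\<dots> \<le> exp (real n * (real (card L) * t) - 2 * real n * \<kappa> * ln t)"
      by (rule card_hamming_ball_le[OF L(1) t]) simp
    also have "\<dots> = ?e" by (simp add: algebra_simps)
    finally show ?thesis .
  qed
  have finE: "finite E" using E(1) Z(1) by (rule finite_subset)
  have "Z \<subseteq> (\<Union>e\<in>E. {z \<in> Z. bowen_dist T n e z \<le> d})" using E(3) by auto
  then have "card Z \<le> card (\<Union>e\<in>E. {z \<in> Z. bowen_dist T n e z \<le> d})"
    using finE Z(1) by (intro card_mono) auto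
  also have "\<dots> \<le> (\<Sum>e\<in>E. card {z \<in> Z. bowen_dist T n e z \<le> d})"
    by (rule card_UN_le[OF finE])
  finally have "real (card Z) \<le> (\<Sum>e\<in>E. real (card {z \<in> Z. bowen_dist T n e z \<le> d}))"
    by (simp flip: of_nat_sum)
  also have "\<dots> \<le> (\<Sum>e\<in>E. ?e)" by (intro sum_mono ball)
  finally have "real (card Z) \<le> real (card E) * ?e" by simp
  with E show ?thesis by (intro exI[of _ E]) (auto simp: not_le)
qed

lemma compact_closed_separated:
  fixes A B :: "'a::metric_space set"
  assumes A: "compact A" and B: "closed B" and disj: "A \<inter> B = {}"
  shows "\<exists>d>0. \<forall>x\<in>A. \<forall>y\<in>B. d \<le> dist x y"
proof (cases "A = {} \<or> B = {}")
  case True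
  then show ?thesis by (intro exI[of _ 1]) auto
next
  case False
  have "continuous_on A (\<lambda>x. infdist x B)" by (intro continuous_intros)
  then obtain a where a: "a \<in> A" "\<And>x. x \<in> A \<Longrightarrow> infdist a B \<le> infdist x B"
    using continuous_attains_inf[OF A] False by blast
  have "infdist a B \<noteq> 0" using in_closed_iff_infdist_zero[OF B] False a(1) disj by blast
  then have "0 < infdist a B" using infdist_nonneg[of a B] by linarith
  moreover have "infdist a B \<le> dist x y" if "x \<in> A" "y \<in> B" for x y
    using a(2)[OF that(1)] infdist_le[OF that(2), of x] by linarith
  ultimately show ?thesis by blast
qed

section \<open>Lower bound for the pressure of stable sets\<close>

locale stable_counting = labelled_ergodic M T l L
  for M :: "'a::metric_space measure" and T :: "'a \<Rightarrow> 'a" and l :: "'a \<Rightarrow> 'b" and L :: "'b set" +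
  fixes f :: "'a \<Rightarrow> real" and \<epsilon> :: real
  assumes borel: "sets M = sets borel"
    and compact_space: "compact (UNIV :: 'a set)"
    and T_continuous: "continuous_on UNIV T"
    and f_continuous: "continuous_on UNIV f"
    and l_diameter: "l x = l y \<Longrightarrow> dist x y \<le> \<epsilon>"
begin

lemma f_measurable [measurable]: "f \<in> borel_measurable M"
  unfolding measurable_cong_sets[OF borel refl] by (rule borel_measurable_continuous_onI[OF f_continuous])

lemma f_bounded: "\<exists>B. \<forall>x. \<bar>f x\<bar> \<le> B"
proof -
  have "bounded (range f)"
    using compact_continuous_image[OF f_continuous compact_space] by (rule compact_imp_bounded)
  then show ?thesis by (auto simp: bounded_iff)
qed

lemma l_vimage_sets: "l -` {b} \<in> events"
  using cyl_sets[of "[b]"] by (simp add: cyl_Cons cyl_Nil)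

text \<open>Each label class is replaced by a closed subset of almost the same measure. These are
  disjoint compact sets, hence at positive mutual distances, and \<open>B\<close> collects what was
  removed.\<close>

lemma separated_labels:
  assumes e: "0 < e"
  obtains B d where "B \<in> events" "prob B < e" "0 < d"
    "\<And>x y. x \<notin> B \<Longrightarrow> y \<notin> B \<Longrightarrow> dist x y \<le> d \<Longrightarrow> l x = l y"
proof -
  have fm: "finite_measure M" by unfold_locales
  have "L \<noteq> {}" using l_in by auto
  then have cL: "0 < real (card L)" using finite_L by (simp add: card_gt_0_iff)
  have "\<exists>F. closed F \<and> F \<subseteq> l -` {b} \<and> prob (l -` {b} - F) < e / real (card L)" for b
    using inner_regular_closed[OF fm borel l_vimage_sets, of "e / real (card L)" b] e cL by auto
  then obtain K where K: "\<And>b. closed (K b)" "\<And>b. K b \<subseteq> l -` {b}"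
    "\<And>b. prob (l -` {b} - K b) < e / real (card L)"
    by metis
  have KM: "K b \<in> events" for b using K(1) borel by auto
  define B where "B = (\<Union>b\<in>L. l -` {b} - K b)"
  have BM: "B \<in> events" unfolding B_def using finite_L KM l_vimage_sets by auto
  have "prob B \<le> (\<Sum>b\<in>L. prob (l -` {b} - K b))"
    unfolding B_def using finite_L KM l_vimage_sets by (intro finite_measure_subadditive_finite) auto
  also have "\<dots> < (\<Sum>b\<in>L. e / real (card L))"
    using finite_L \<open>L \<noteq> {}\<close> K(3) by (intro sum_strict_mono) auto
  also have "\<dots> = e" using cL by simp
  finally have Be: "prob B < e" .
  have K_iff: "x \<in> K (l x)" if "x \<notin> B" for x using that l_in[of x] by (auto simp: B_def)
  have "\<exists>d>0. \<forall>x\<in>K a. \<forall>y\<in>K b. d \<le> dist x y" if "a \<noteq> b" for a b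
  proof -
    have "compact (K a)" using closed_Int_compact[OF K(1) compact_space, of a] by simp
    moreover have "K a \<inter> K b = {}" using K(2)[of a] K(2)[of b] that by auto
    ultimately show ?thesis using compact_closed_separated[OF _ K(1)] by blast
  qed
  then obtain \<delta> where \<delta>: "\<And>a b. a \<noteq> b \<Longrightarrow> 0 < \<delta> a b"
    "\<And>a b x y. a \<noteq> b \<Longrightarrow> x \<in> K a \<Longrightarrow> y \<in> K b \<Longrightarrow> \<delta> a b \<le> dist x y"
    by metis
  \<comment> \<open>The element 1 keeps \<open>R\<close> nonempty when there is only one label.
    Halving \<open>Min R\<close> below turns the non-strict distance bounds into a
    contradiction.\<close>
  define R where "R = insert 1 ((\<lambda>(a, b). \<delta> a b) ` {(a, b) \<in> L \<times> L. a \<noteq> b})"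
  have finR: "finite R" unfolding R_def using finite_L by (auto intro: finite_subset[of _ "L \<times> L"])
  have posR: "0 < Min R" using finR \<delta>(1) by (subst Min_gr_iff) (auto simp: R_def)
  have "l x = l y" if "x \<notin> B" "y \<notin> B" "dist x y \<le> Min R / 2" for x y
  proof (rule ccontr)
    assume neq: "l x \<noteq> l y"
    then have "\<delta> (l x) (l y) \<in> R" using l_in by (auto simp: R_def)
    then have "Min R \<le> \<delta> (l x) (l y)" by (rule Min_le[OF finR])
    also have "\<dots> \<le> dist x y" using \<delta>(2)[OF neq] K_iff that by blast
    finally show False using that posR by simp
  qed
  moreover have "0 < Min R / 2" using posR by simp
  ultimately show ?thesis using that BM Be by blast
qed

text \<open>Markov's inequality for the number of visits, whose mean is \<open>n * prob B\<close> by
  invariance.\<close>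

lemma prob_rare_visits:
  assumes B: "B \<in> events" and \<kappa>: "0 < \<kappa>" and n: "0 < n"
  shows "prob {z. real n * \<kappa> < real (card {i. i < n \<and> (T ^^ i) z \<in> B})} \<le> prob B / \<kappa>"
proof -
  let ?S = "birkhoff_sum T (indicator B) n"
  have [measurable]: "(indicator B :: 'a \<Rightarrow> real) \<in> borel_measurable M" using B by simp
  have S: "?S z = real (card {i. i < n \<and> (T ^^ i) z \<in> B})" for z
  proof -
    have "?S z = (\<Sum>i<n. of_bool ((T ^^ i) z \<in> B))"
      unfolding birkhoff_sum_def by (intro sum.cong) (auto split: split_indicator)
    also have "\<dots> = real (card {i \<in> {..<n}. (T ^^ i) z \<in> B})"
      by (simp add: sum.inter_filter[symmetric] of_bool_def)
    finally show ?thesis by simp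
  qed
  have bd: "\<bar>indicator B x :: real\<bar> \<le> 1" for x by (simp split: split_indicator)
  have int: "integrable M ?S"
    using abs_birkhoff_sum_le[of "indicator B" 1 T n, OF bd]
    by (intro integrable_const_bound[of _ "real n * 1"]) auto
  have ES: "(\<integral>x. ?S x \<partial>M) = real n * prob B"
    using integral_birkhoff_sum[of "indicator B" 1 n] bd B by simp
  have pos: "0 < real n * \<kappa>" using \<kappa> n by simp
  have "prob {z. real n * \<kappa> < ?S z} \<le> prob {z \<in> space M. real n * \<kappa> \<le> ?S z}"
  proof (rule finite_measure_mono)
    show "{z \<in> space M. real n * \<kappa> \<le> ?S z} \<in> events" by measurable
  qed (auto simp: space_UNIV)
  also have "\<dots> \<le> (\<integral>x. ?S x \<partial>M) / (real n * \<kappa>)"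
    using integral_Markov_inequality_measure[OF int, of "{}" "real n * \<kappa>"] pos
    by (simp add: S)
  also have "\<dots> = prob B / \<kappa>" using n by (simp add: ES)
  finally show ?thesis by (simp add: S)
qed

lemma Ps_lower_bound:
  assumes c: "c < entropy_rate + (\<integral>x. f x \<partial>M)" and z: "0 < z"
  shows "\<exists>S\<in>events. 1 - z \<le> prob S \<and> (\<forall>x\<in>S. ereal c \<le> Ps T f x \<epsilon>)"
proof -
  define F where "F = (\<integral>x. f x \<partial>M)"
  \<comment> \<open>Five losses of \<open>r\<close> are budgeted: one for the information, two for
    separation, one for the Birkhoff sums of \<open>f\<close>, and one to absorb the factor
    1/2.\<close>
  define r where "r = (entropy_rate + F - c) / 5"
  have r: "0 < r" using c by (simp add: r_def F_def)
  define t where "t = min 1 (r / (real (card L) + 1))"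
  have t: "0 < t" "t \<le> 1" using r by (auto simp: t_def)
  have Lt: "real (card L) * t \<le> r"
  proof -
    have "real (card L) * t \<le> real (card L) * (r / (real (card L) + 1))"
      by (intro mult_left_mono) (auto simp: t_def)
    also have "\<dots> \<le> r" using r by (simp add: field_simps)
    finally show ?thesis .
  qed
  have lt: "ln t \<le> 0" using t by simp
  \<comment> \<open>First \<open>t\<close> makes \<open>card L * t \<le> r\<close>, then
    \<open>\<kappa>\<close> makes \<open>- 2 * \<kappa> * ln t \<le> r\<close>. The 1 in the
    denominator covers \<open>t = 1\<close>.\<close>
  define \<kappa> where "\<kappa> = r / (2 * (1 - ln t))"
  have \<kappa>: "0 < \<kappa>" using r lt by (simp add: \<kappa>_def)
  have \<kappa>t: "- 2 * \<kappa> * ln t \<le> r" using r lt by (simp add: \<kappa>_def field_simps)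
  obtain B d where BM: "B \<in> events" and Bp: "prob B < \<kappa> * (z / 6)" and d: "0 < d"
    and sep: "\<And>x y. x \<notin> B \<Longrightarrow> y \<notin> B \<Longrightarrow> dist x y \<le> d \<Longrightarrow> l x = l y"
    using separated_labels[of "\<kappa> * (z / 6)"] \<kappa> z by auto
  obtain n1 k where n1: "\<And>n N. n1 \<le> n \<Longrightarrow> k \<le> N \<Longrightarrow>
      prob {x. block_info n N x < real n * (entropy_rate - r)} \<le> z / 6"
    using block_info_lower[OF r, of "z / 6"] z by auto
  obtain Bf where Bf: "\<And>x. \<bar>f x\<bar> \<le> Bf" using f_bounded by blast
  obtain n2 where n2: "\<And>n. n2 \<le> n \<Longrightarrow> prob {x. birkhoff_sum T f n x < real n * (F - r)} \<le> z / 6"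
    using birkhoff_lower_tail[OF f_measurable Bf r, of "z / 6"] z unfolding F_def by auto
  obtain n3 :: nat where n3: "ln 2 / r < real n3" using reals_Archimedean2 by blast
  define n0 where "n0 = max 1 (max n1 (max n2 n3))"
  \<comment> \<open>The typical points. The first condition fails on a null set and the other three
    with probability at most \<open>z / 6\<close> each; the resulting \<open>z / 2\<close> is
    doubled by \<open>prob_large_fibre\<close>.\<close>
  define G where "G n N = {x. 0 < p (wd (n + N) x) \<and> real n * (entropy_rate - r) \<le> block_info n N x \<and>
      real n * (F - r) \<le> birkhoff_sum T f n x \<and>
      real (card {i. i < n \<and> (T ^^ i) x \<in> B}) \<le> real n * \<kappa>}" for n N
  have Gc: "G n N \<in> events \<and> 1 - z / 2 \<le> prob (G n N)" if "n0 \<le> n" "k \<le> N" for n N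
  proof -
    let ?A1 = "{x. \<not> 0 < p (wd (n + N) x)}"
    let ?A2 = "{x. block_info n N x < real n * (entropy_rate - r)}"
    let ?A3 = "{x. birkhoff_sum T f n x < real n * (F - r)}"
    let ?A4 = "{x. real n * \<kappa> < real (card {i. i < n \<and> (T ^^ i) x \<in> B})}"
    have A1: "?A1 \<in> events" by (rule word_event)
    have A2: "?A2 \<in> events"
    proof -
      have "{x \<in> space M. block_info n N x < real n * (entropy_rate - r)} \<in> events" by measurable
      then show ?thesis by (simp add: space_UNIV)
    qed
    have A3: "?A3 \<in> events"
    proof -
      have "{x \<in> space M. birkhoff_sum T f n x < real n * (F - r)} \<in> events" by measurable
      then show ?thesis by (simp add: space_UNIV)
    qed
    have A4: "?A4 \<in> events"
    proof -
      have "{x \<in> space M. real n * \<kappa> < (\<Sum>i<n. indicator B ((T ^^ i) x))} \<in> events"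
        using BM by measurable
      moreover have "(\<Sum>i<n. indicator B ((T ^^ i) x)) = real (card {i. i < n \<and> (T ^^ i) x \<in> B})" for x
        by (simp add: indicator_def of_bool_def sum.inter_filter[symmetric])
      ultimately show ?thesis by (simp add: space_UNIV)
    qed
    have p1: "prob ?A1 = 0"
      using AE_p_word_pos[of "n + N"] prob_eq_0[OF A1] by simp
    have p2: "prob ?A2 \<le> z / 6" using that n1 by (simp add: n0_def)
    have p3: "prob ?A3 \<le> z / 6" using that n2 by (simp add: n0_def)
    have "prob ?A4 \<le> prob B / \<kappa>" using that by (intro prob_rare_visits[OF BM \<kappa>]) (simp add: n0_def)
    also have "\<dots> \<le> z / 6" using Bp \<kappa> by (simp add: pos_divide_le_eq mult.commute)
    finally have p4: "prob ?A4 \<le> z / 6" .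
    have G: "G n N = - (?A1 \<union> ?A2 \<union> (?A3 \<union> ?A4))" by (auto simp: G_def)
    have U: "?A1 \<union> ?A2 \<union> (?A3 \<union> ?A4) \<in> events" using A1 A2 A3 A4 by (intro sets.Un)
    have "prob (?A1 \<union> ?A2 \<union> (?A3 \<union> ?A4)) \<le> (prob ?A1 + prob ?A2) + (prob ?A3 + prob ?A4)"
      by (intro order_trans[OF measure_Un_le] add_mono measure_Un_le sets.Un A1 A2 A3 A4)
    also have "\<dots> \<le> z / 2" using p1 p2 p3 p4 by simp
    finally have "prob (?A1 \<union> ?A2 \<union> (?A3 \<union> ?A4)) \<le> z / 2" .
    then show ?thesis
      using prob_Compl[OF U] Compl_sets[OF U] unfolding G by simp
  qed
  define A where "A n N = {x. 0 < p (wd N x) \<and>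
      p (wd N x) / 2 \<le> prob (G n N \<inter> (T ^^ n) -` cyl (wd N x))}" for n N
  have AM: "A n N \<in> events" for n N unfolding A_def by (rule word_event)
  have Ap: "1 - z \<le> prob (A n N)" if "n0 \<le> n" "k \<le> N" for n N
    using prob_large_fibre[of "G n N" "z / 2" N n] Gc[OF that] unfolding A_def by simp
  \<comment> \<open>For \<open>x\<close> in \<open>A' n\<close> the fibre is good for infinitely
    many \<open>N\<close> with \<open>n\<close> fixed, as the compactness argument demands;
    \<open>S\<close> then asks for infinitely many \<open>n\<close>.\<close>
  define A' where "A' n = (\<Inter>i. \<Union>N\<in>{i..}. A n N)" for n
  have A'M: "A' n \<in> events" for n unfolding A'_def using AM by auto
  have A'p: "1 - z \<le> prob (A' n)" if "n0 \<le> n" for n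
    unfolding A'_def using Ap[OF that] by (intro prob_limsup_ge AM)
  define S where "S = (\<Inter>i. \<Union>n\<in>{i..}. A' n)"
  have SM: "S \<in> events" unfolding S_def using A'M by auto
  have Sp: "1 - z \<le> prob S"
    unfolding S_def using A'p by (intro prob_limsup_ge A'M)
  have points: "\<exists>E. finite E \<and> exp (real n * (entropy_rate - 3 * r)) / 2 \<le> real (card E)
      \<and> (\<forall>x\<in>E. \<forall>y\<in>E. x \<noteq> y \<longrightarrow> d < bowen_dist T n x y)
      \<and> (\<forall>z\<in>E. real n * (F - r) \<le> birkhoff_sum T f n z)
      \<and> (\<forall>z\<in>E. \<forall>j<N. dist ((T ^^ j) x) ((T ^^ j) ((T ^^ n) z)) \<le> \<epsilon>)"
    if n: "n0 \<le> n" and N: "k \<le> N" and x: "x \<in> A n N" for n N x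
  proof -
    let ?D = "G n N \<inter> (T ^^ n) -` cyl (wd N x)"
    have DM: "?D \<in> events"
      using Gc[OF n N] measurable_sets[OF iterate_measurable cyl_sets, of n "wd N x"]
      by (auto simp: space_UNIV)
    have card: "exp (real n * (entropy_rate - r)) / 2 \<le> real (card (wd n ` ?D))"
      by (rule card_words_lower[OF DM, of n "wd N x" N]) (use x in \<open>auto simp: A_def G_def\<close>)
    \<comment> \<open>One point is chosen for each \<open>n\<close>-word occurring in the
      fibre.\<close>
    obtain Z where Z: "Z \<subseteq> ?D" "inj_on (wd n) Z" "wd n ` ?D = wd n ` Z"
      using subset_image_inj[of "wd n ` ?D" "wd n" ?D] by auto
    have "finite (wd n ` Z)" using word_in by (intro finite_subset[OF _ finite_W[of n]]) auto
    then have finZ: "finite Z" using Z(2) by (simp add: finite_image_iff)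
    have "0 < n" using n by (simp add: n0_def)
    have rare: "real (card {i. i < n \<and> (T ^^ i) z \<in> B}) \<le> real n * \<kappa>" if "z \<in> Z" for z
      using that Z(1) by (auto simp: G_def)
    obtain E where E: "E \<subseteq> Z" "\<forall>x\<in>E. \<forall>y\<in>E. x \<noteq> y \<longrightarrow> d < bowen_dist T n x y"
      "real (card Z) \<le> real (card E) * exp (real n * (real (card L) * t - 2 * \<kappa> * ln t))"
      using separated_subset_card[of L l t n d B Z T \<kappa>, OF finite_L l_in t \<open>0 < n\<close> less_imp_le[OF d] sep finZ Z(2) rare]
      by blast
    have "exp (real n * (entropy_rate - r)) / 2 \<le> real (card Z)"
      using card card_image[OF Z(2)] Z(3) by simp
    also have "\<dots> \<le> real (card E) * exp (real n * (2 * r))"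
    proof -
      have "real n * (real (card L) * t - 2 * \<kappa> * ln t) \<le> real n * (2 * r)"
        using Lt \<kappa>t by (intro mult_left_mono) auto
      then show ?thesis by (intro order_trans[OF E(3)] mult_left_mono) simp_all
    qed
    finally have "exp (real n * (entropy_rate - r)) / 2 \<le> real (card E) * exp (real n * (2 * r))" .
    then have "exp (real n * (entropy_rate - r)) / exp (real n * (2 * r)) / 2 \<le> real (card E)"
      by (simp add: field_simps)
    then have cE: "exp (real n * (entropy_rate - 3 * r)) / 2 \<le> real (card E)"
      unfolding exp_diff[symmetric] by (simp add: algebra_simps)
    have ED: "z \<in> G n N" "wd N ((T ^^ n) z) = wd N x" if "z \<in> E" for z
      using that E(1) Z(1) by (auto simp: cyl_def)
    have "dist ((T ^^ j) x) ((T ^^ j) ((T ^^ n) z)) \<le> \<epsilon>" if "z \<in> E" "j < N" for z j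
    proof (rule l_diameter)
      show "l ((T ^^ j) x) = l ((T ^^ j) ((T ^^ n) z))"
        using nth_word[OF that(2), of T l x] nth_word[OF that(2), of T l "(T ^^ n) z"] ED(2)[OF that(1)] by simp
    qed
    moreover have "finite E" using E(1) finZ by (rule finite_subset)
    moreover have "\<forall>z\<in>E. real n * (F - r) \<le> birkhoff_sum T f n z" using ED(1) by (auto simp: G_def)
    ultimately show ?thesis using E(2) cE by blast
  qed
  have "ereal c \<le> Ps T f x \<epsilon>" if x: "x \<in> S" for x
  proof (rule Ps_ge)
    show "0 < d / 2" using d by simp
    fix i :: nat
    have "x \<in> (\<Union>n\<in>{max i n0..}. A' n)" using x unfolding S_def by blast
    then obtain n where n: "max i n0 \<le> n" "x \<in> A' n" by blast
    have n': "0 < n" "n0 \<le> n" using n by (auto simp: n0_def)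
    have "ereal (exp (real n * (entropy_rate - 3 * r)) / 2 * exp (real n * (F - r))) \<le>
        Pn T f n (d / 2) ((T ^^ n) -` stable_set T \<epsilon> x)"
    proof (rule separated_points_limit[OF compact_space T_continuous f_continuous n'(1) d])
      fix j :: nat
      have "x \<in> (\<Union>N\<in>{max j k..}. A n N)" using n(2) unfolding A'_def by blast
      then obtain N where "max j k \<le> N" "x \<in> A n N" by blast
      then show "\<exists>N\<ge>j. \<exists>E. finite E \<and> exp (real n * (entropy_rate - 3 * r)) / 2 \<le> real (card E)
          \<and> (\<forall>x\<in>E. \<forall>y\<in>E. x \<noteq> y \<longrightarrow> d < bowen_dist T n x y)
          \<and> (\<forall>z\<in>E. real n * (F - r) \<le> birkhoff_sum T f n z)
          \<and> (\<forall>z\<in>E. \<forall>j<N. dist ((T ^^ j) x) ((T ^^ j) ((T ^^ n) z)) \<le> \<epsilon>)"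
        using points[OF n'(2), of N x] by (intro exI[of _ N]) simp
    qed
    moreover have "exp (real n * c) \<le> exp (real n * (entropy_rate - 3 * r)) / 2 * exp (real n * (F - r))"
    proof -
      have "ln 2 / r < real n" using n3 n'(2) by (simp add: n0_def)
      then have "ln 2 \<le> real n * r" using r by (simp add: field_simps)
      then have "exp (ln 2) \<le> exp (real n * r)" by (simp only: exp_le_cancel_iff)
      then have "exp (real n * c) * 2 \<le> exp (real n * c) * exp (real n * r)" by simp
      also have "\<dots> = exp (real n * (entropy_rate - 3 * r)) * exp (real n * (F - r))"
        unfolding exp_add[symmetric] by (simp add: r_def field_simps)
      finally show ?thesis by simp
    qed
    ultimately have "ereal (exp (real n * c)) \<le> Pn T f n (d / 2) ((T ^^ n) -` stable_set T \<epsilon> x)"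
      by (meson ereal_less_eq(3) order_trans)
    then show "\<exists>n\<ge>i. 0 < n \<and> ereal (exp (real n * c)) \<le> Pn T f n (d / 2) ((T ^^ n) -` stable_set T \<epsilon> x)"
      using n n' by auto
  qed
  with SM Sp show ?thesis by blast
qed

lemma AE_Ps_ge:
  assumes c: "c < entropy_rate + (\<integral>x. f x \<partial>M)"
  shows "AE x in M. ereal c \<le> Ps T f x \<epsilon>"
proof -
  have "\<exists>S\<in>events. 1 - 1 / real (Suc j) \<le> prob S \<and> (\<forall>x\<in>S. ereal c \<le> Ps T f x \<epsilon>)" for j
    by (rule Ps_lower_bound[OF c]) simp
  then obtain S where S: "\<And>j. S j \<in> events" "\<And>j. 1 - 1 / real (Suc j) \<le> prob (S j)"
    "\<And>j x. x \<in> S j \<Longrightarrow> ereal c \<le> Ps T f x \<epsilon>"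
    by metis
  have U: "(\<Union>j. S j) \<in> events" using S(1) by auto
  have "1 - 1 / real (Suc j) \<le> prob (\<Union>j. S j)" for j
    using S(2)[of j] finite_measure_mono[OF _ U, of "S j"] by fastforce
  moreover have "(\<lambda>j. 1 - 1 / real (Suc j)) \<longlonglongrightarrow> 1 - 0"
    by (intro tendsto_intros LIMSEQ_Suc lim_1_over_n)
  ultimately have "1 \<le> prob (\<Union>j. S j)"
    by (intro LIMSEQ_le_const2[of _ "1 :: real"]) auto
  then have "prob (\<Union>j. S j) = 1" using prob_le_1[of "\<Union>j. S j"] by linarith
  then have "AE x in M. x \<in> (\<Union>j. S j)" using prob_eq_1[OF U] by simp
  then show ?thesis by (rule eventually_mono) (use S(3) in auto)
qed

end

section \<open>Partitions as labels\<close>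

definition partition_label :: "'a set set \<Rightarrow> 'a \<Rightarrow> 'a set" where
  "partition_label P x = (THE A. A \<in> P \<and> x \<in> A)"

context mps
begin

lemma partition_label_eq:
  assumes "meas_partition M P" and "A \<in> P" and "x \<in> A"
  shows "partition_label P x = A"
  unfolding partition_label_def
proof (rule the_equality)
  fix B assume "B \<in> P \<and> x \<in> B"
  then show "B = A" using assms by (auto simp: meas_partition_def dest: disjointD)
qed (use assms in simp)

lemma partition_label_in:
  assumes "meas_partition M P"
  shows "partition_label P x \<in> P" and "x \<in> partition_label P x"
proof -
  have "x \<in> \<Union>P" using assms by (simp add: meas_partition_def space_UNIV)
  then obtain A where "A \<in> P" "x \<in> A" by blast
  with partition_label_eq[OF assms this] show "partition_label P x \<in> P" "x \<in> partition_label P x" by simp_all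
qed

lemma partition_label_iff:
  "meas_partition M P \<Longrightarrow> A \<in> P \<Longrightarrow> partition_label P x = A \<longleftrightarrow> x \<in> A"
  using partition_label_eq partition_label_in by blast

lemma labelled_mpsI:
  assumes L: "finite L" "\<And>x. l x \<in> L" "\<And>b. b \<in> L \<Longrightarrow> l -` {b} \<in> events"
  shows "labelled_mps M T l L"
proof
  show "l \<in> measurable M (count_space L)"
    unfolding measurable_count_space_eq2[OF L(1)] using L by (auto simp: space_UNIV)
qed (rule L(1))

lemma partition_labelled_mps:
  assumes P: "meas_partition M P"
  shows "labelled_mps M T (partition_label P) P"
proof (rule labelled_mpsI)
  fix A assume A: "A \<in> P"
  then have "partition_label P -` {A} = A" using partition_label_iff[OF P] by auto
  then show "partition_label P -` {A} \<in> events" using A P by (auto simp: meas_partition_def)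
qed (use P partition_label_in in \<open>auto simp: meas_partition_def\<close>)

text \<open>The cells of the join are the nonempty cylinders of the itinerary labelling, and empty
  cylinders contribute 0 to the entropy. Thus the limit defining partition entropy is the entropy
  rate.\<close>

lemma entropy_partition_T_eq:
  assumes P: "meas_partition M P"
  shows "entropy_partition_T M T P = labelled_mps.entropy_rate M T (partition_label P)"
proof -
  interpret P: labelled_mps M T "partition_label P" P
    by (rule partition_labelled_mps[OF P])
  have "partition_entropy M (join_partition M T P n) = P.word_entropy n" for n
  proof -
    have cyl: "P.cyl w = space M \<inter> (\<Inter>i<n. (T ^^ i) -` (w ! i))" if "w \<in> P.W n" for w
    proof -
      have "x \<in> P.cyl w \<longleftrightarrow> (\<forall>i<n. (T ^^ i) x \<in> w ! i)" for x
      proof -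
        have "x \<in> P.cyl w \<longleftrightarrow> (\<forall>i<n. partition_label P ((T ^^ i) x) = w ! i)"
          using that by (auto simp: P.cyl_def list_eq_iff_nth_eq nth_word)
        also have "\<dots> \<longleftrightarrow> (\<forall>i<n. (T ^^ i) x \<in> w ! i)"
          using that by (auto simp: partition_label_iff[OF P] subset_iff)
        finally show ?thesis .
      qed
      then show ?thesis by (auto simp: space_UNIV)
    qed
    \<comment> \<open>Restricting to nonempty cylinders makes \<open>P.cyl\<close> injective and
      matches the exclusion of the empty cell from the join.\<close>
    let ?V = "{w \<in> P.W n. P.cyl w \<noteq> {}}"
    have join: "join_partition M T P n = P.cyl ` ?V"
    proof (intro subset_antisym subsetI)
      fix C assume "C \<in> join_partition M T P n"
      then obtain a where a: "C \<noteq> {}" "\<forall>i<n. a i \<in> P" "C = space M \<inter> (\<Inter>i<n. (T ^^ i) -` a i)"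
        by (auto simp: join_partition_def)
      have w: "map a [0..<n] \<in> P.W n" using a(2) by auto
      have "C = P.cyl (map a [0..<n])" unfolding cyl[OF w] a(3) by simp
      with w a(1) show "C \<in> P.cyl ` ?V" by blast
    next
      fix C assume "C \<in> P.cyl ` ?V"
      then obtain w where w: "w \<in> P.W n" "P.cyl w \<noteq> {}" "C = P.cyl w" by blast
      then show "C \<in> join_partition M T P n"
        unfolding join_partition_def using cyl[OF w(1)]
        by (intro CollectI conjI exI[of _ "\<lambda>i. w ! i"]) (auto simp: subset_iff)
    qed
    have inj: "inj_on P.cyl ?V"
      by (auto simp: inj_on_def P.cyl_def)
    have "partition_entropy M (join_partition M T P n) = - (\<Sum>w\<in>?V. P.p w * ln (P.p w))"
      unfolding partition_entropy_def join sum.reindex[OF inj] by (simp add: P.p_def)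
    also have "(\<Sum>w\<in>?V. P.p w * ln (P.p w)) = (\<Sum>w\<in>P.W n. P.p w * ln (P.p w))"
      by (rule sum.mono_neutral_left[OF P.finite_W]) (auto simp: P.p_def)
    also have "- \<dots> = P.word_entropy n"
      unfolding P.word_entropy_def P.integral_function_of_word[of "\<lambda>w. - ln (P.p w)"]
      by (simp add: sum_negf)
    finally show ?thesis .
  qed
  then show ?thesis
    unfolding entropy_partition_T_def using P.word_entropy_rate by (simp add: limI)
qed

text \<open>Cylinders of the finer labelling \<open>l'\<close> lie inside those of \<open>l\<close>,
  so the information function of \<open>l'\<close> is pointwise at least as large almost
  everywhere.\<close>

lemma entropy_rate_refine:
  assumes "labelled_mps M T l L" and "labelled_mps M T l' L'" and l: "\<And>x. l x = g (l' x)"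
  shows "labelled_mps.entropy_rate M T l \<le> labelled_mps.entropy_rate M T l'"
proof -
  interpret A: labelled_mps M T l L by fact
  interpret B: labelled_mps M T l' L' by fact
  have "A.word_entropy n \<le> B.word_entropy n" for n
    unfolding A.word_entropy_def B.word_entropy_def
  proof (rule integral_mono_AE)
    show "AE x in M. - ln (A.p (word T l n x)) \<le> - ln (B.p (word T l' n x))"
      using B.AE_p_word_pos[of n]
    proof eventually_elim
      case (elim x)
      have "word T l n y = map g (word T l' n y)" for y by (simp add: word_def l)
      then have "B.cyl (word T l' n x) \<subseteq> A.cyl (word T l n x)"
        by (auto simp: A.cyl_def B.cyl_def)
      then have "B.p (word T l' n x) \<le> A.p (word T l n x)"
        unfolding A.p_def B.p_def by (intro finite_measure_mono A.cyl_sets)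
      with elim show ?case by simp
    qed
  qed (rule A.function_of_word_integrable B.function_of_word_integrable)+
  then have "A.word_entropy n / real n \<le> B.word_entropy n / real n" for n
    by (intro divide_right_mono) simp_all
  then show ?thesis
    by (intro LIMSEQ_le[OF A.word_entropy_rate B.word_entropy_rate]) blast
qed

end

theorem theorem5p4:
  fixes T :: "'a::metric_space \<Rightarrow> 'a" and f :: "'a \<Rightarrow> real" and M :: "'a measure"
  assumes "compact (UNIV :: 'a set)"
    and "continuous_on UNIV T" and "surj T" and "\<not> inj T"
    and "continuous_on UNIV f"
    and "prob_space M" and "sets M = sets borel"
    and "ergodic_measure M T"
    and "ks_entropy M T > 0"
  shows "AE x in M. Lim (at_right 0) (\<lambda>\<epsilon>. Ps T f x \<epsilon>) \<ge> measure_pressure M T f"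
proof -
  interpret prob_space M by fact
  have space: "space M = UNIV" using sets_eq_imp_space_eq[OF \<open>sets M = sets borel\<close>] by simp
  interpret ergodic_mps M T
    by unfold_locales
      (use \<open>ergodic_measure M T\<close> space in \<open>auto simp: ergodic_measure_def invariant_measure_def\<close>)
  have AE_Ps: "AE x in M. ereal c \<le> Ps T f x \<epsilon>"
    if c: "ereal c < measure_pressure M T f" and \<epsilon>: "0 < \<epsilon>" for c \<epsilon>
  proof -
    \<comment> \<open>Subtracting the finite integral leaves a bound on entropy alone, valid also if
      entropy is infinite; a partition nearly attaining the supremum then exists.\<close>
    have "ereal (c - (\<integral>x. f x \<partial>M)) < ks_entropy M T"
      using c unfolding measure_pressure_def by (cases "ks_entropy M T") auto
    then obtain P where P: "meas_partition M P"
      and cP: "c - (\<integral>x. f x \<partial>M) < entropy_partition_T M T P"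
      unfolding ks_entropy_def less_SUP_iff by auto
    have "\<exists>K. finite K \<and> (UNIV :: 'a set) \<subseteq> (\<Union>x\<in>K. ball x (\<epsilon> / 2))"
      using \<open>compact (UNIV :: 'a set)\<close> \<epsilon> unfolding compact_eq_totally_bounded by simp
    then obtain K :: "'a set" where K: "finite K" "UNIV \<subseteq> (\<Union>x\<in>K. ball x (\<epsilon> / 2))" by blast
    \<comment> \<open>The label records which balls of a finite cover contain \<open>x\<close>.
      Equal labels give a common ball of radius \<open>\<epsilon> / 2\<close>, and pairing with the
      partition label keeps the entropy at least that of \<open>P\<close>.\<close>
    define \<alpha> where "\<alpha> x = {c \<in> K. x \<in> ball c (\<epsilon> / 2)}" for x
    define l where "l x = (partition_label P x, \<alpha> x)" for x
    have lab: "labelled_mps M T l (P \<times> Pow K)"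
    proof (rule labelled_mpsI)
      show "finite (P \<times> Pow K)" using P K(1) by (simp add: meas_partition_def)
      show "l x \<in> P \<times> Pow K" for x
        using partition_label_in[OF P] by (auto simp: l_def \<alpha>_def)
      fix b assume "b \<in> P \<times> Pow K"
      then obtain A S where b: "b = (A, S)" "A \<in> P" "S \<subseteq> K" by auto
      define U where "U c = (if c \<in> S then ball c (\<epsilon> / 2) else - ball c (\<epsilon> / 2))" for c
      have "x \<in> U c \<longleftrightarrow> (c \<in> S \<longleftrightarrow> x \<in> ball c (\<epsilon> / 2))" for x c by (simp add: U_def)
      then have U: "x \<in> (\<Inter>c\<in>K. U c) \<longleftrightarrow> \<alpha> x = S" for x
        using b(3) unfolding \<alpha>_def by blast
      have "l -` {b} = A \<inter> (\<Inter>c\<in>K. U c)"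
        by (rule set_eqI) (simp add: l_def b(1) partition_label_iff[OF P b(2)] U[simplified])
      moreover have "(\<Inter>c\<in>K. U c) \<in> events"
      proof (rule sets.finite_INT[OF K(1)])
        show "K \<noteq> {}" using K(2) by auto
        show "U c \<in> events" for c
          using \<open>sets M = sets borel\<close> by (auto simp: U_def)
      qed
      moreover have "A \<in> events" using P b(2) by (auto simp: meas_partition_def)
      ultimately show "l -` {b} \<in> events" by simp
    qed
    interpret labelled_mps M T l "P \<times> Pow K" by (rule lab)
    interpret stable_counting M T l "P \<times> Pow K" f \<epsilon>
    proof
      fix x y assume "l x = l y"
      then have "\<alpha> x = \<alpha> y" by (simp add: l_def)
      obtain a where "a \<in> K" "x \<in> ball a (\<epsilon> / 2)" using K(2) by blast
      then have "a \<in> \<alpha> x" by (simp add: \<alpha>_def)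
      then have "dist a x < \<epsilon> / 2" "dist a y < \<epsilon> / 2"
        unfolding atomize_conj using \<open>\<alpha> x = \<alpha> y\<close> by (auto simp: \<alpha>_def)
      then show "dist x y \<le> \<epsilon>" using dist_triangle3[of x y a] by simp
    qed fact+
    have "entropy_partition_T M T P \<le> entropy_rate"
      unfolding entropy_partition_T_eq[OF P]
      by (rule entropy_rate_refine[OF partition_labelled_mps[OF P] lab, where g = fst]) (simp add: l_def)
    with cP show ?thesis by (intro AE_Ps_ge) simp
  qed
  \<comment> \<open>Countably many thresholds and scales give one exceptional null set; monotonicity
    in \<epsilon> and density of the rationals recover the rest.\<close>
  have "AE x in M. \<forall>(q::rat) m::nat. ereal (of_rat q) < measure_pressure M T f \<longrightarrow>
      ereal (of_rat q) \<le> Ps T f x (1 / real (Suc m))"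
    unfolding AE_all_countable
  proof (intro allI)
    fix q :: rat and m :: nat
    show "AE x in M. ereal (of_rat q) < measure_pressure M T f \<longrightarrow>
        ereal (of_rat q) \<le> Ps T f x (1 / real (Suc m))"
      using AE_Ps[of "of_rat q" "1 / real (Suc m)"]
      by (cases "ereal (of_rat q) < measure_pressure M T f") simp_all
  qed
  then show ?thesis
  proof eventually_elim
    case (elim x)
    show ?case
      unfolding Lim_Ps
    proof (rule INF_greatest)
      fix \<epsilon> :: real assume "\<epsilon> \<in> {0<..}"
      then obtain m where m: "1 / real (Suc m) < \<epsilon>" using nat_approx_posE by auto
      show "measure_pressure M T f \<le> Ps T f x \<epsilon>"
      proof (rule ccontr)
        assume "\<not> measure_pressure M T f \<le> Ps T f x \<epsilon>"
        then obtain q :: rat where q: "Ps T f x \<epsilon> < ereal (of_rat q)" "ereal (of_rat q) < measure_pressure M T f"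
          using ereal_dense3 not_le by metis
        have "ereal (of_rat q) \<le> Ps T f x (1 / real (Suc m))" using elim q(2) by blast
        also have "\<dots> \<le> Ps T f x \<epsilon>" using m by (intro Ps_mono) simp
        finally show False using q(1) by simp
      qed
    qed
  qed
qed

end
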